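(* (NM($d$)-GARCH(1,1).) Let $D\ge1$ be an integer, $\mathsf X=(0,\infty)^D$ with its usual topology, $\mathsf Y=\mathbb R$, $\nu$ the Lebesgue measure on $\mathbb R$, and let $\mathsf P_D=\{\boldsymbol\gamma\in\mathbb R_+^D:\sum_{\ell=1}^D\gamma_\ell=1\}$. Let $\Theta$ be a compact subset of $\mathsf P_D\times(0,\infty)^D\times\mathbb R_+^{D\times D}\times\mathbb R_+^D$ with generic element $\theta=(\boldsymbol\gamma,\boldsymbol\omega,\mathbf A,\mathbf b)$. Set $$\psi^\theta_y(\mathbf x)=\boldsymbol\omega+\mathbf A\mathbf x+y^2\mathbf b,\qquad g^\theta(\mathbf x;y)=\sum_{\ell=1}^D\gamma_\ell\,\frac{e^{-y^2/(2x_\ell)}}{(2\pi x_\ell)^{1/2}},\qquad(\mathbf x,y)\in\mathsf X\times\mathsf Y,$$ $G^\theta(\mathbf x;dy)=g^\theta(\mathbf x;y)\,\nu(dy)$, and let $K^\theta$ be the associated observation-driven transition kernel on $\mathsf X\times\mathsf Y$. Suppose that every $\theta=(\boldsymbol\gamma,\boldsymbol\omega,\mathbf A,\mathbf b)\in\Theta$ satisfies $|\lambda|_{\max}(\mathbf A+\mathbf b\boldsymbol\gamma^T)<1$, where $|\lambda|_{\max}(\mathbf M)$ denotes the spectral radius of the square matrix $\mathbf M$. Let $\bar V$ be the restriction to $\mathsf X$ of any norm on $\mathbb R^D$. Then: (1) For all $\theta\in\Theta$, $K^\theta$ admits a unique stationary distribution $\pi^\theta$ on $\mathsf X\times\mathsf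 Y$. (2) For all $\theta\in\Theta$, $\pi^\theta_1(\bar V)<\infty$, where $\pi_1^\theta$ is the marginal of $\pi^\theta$ on $\mathsf X$. (3) For all $y\in\mathsf Y$, the functions $(\theta,\mathbf x)\mapsto g^\theta(\mathbf x;y)$ and $(\theta,\mathbf x)\mapsto\psi^\theta_y(\mathbf x)$ are continuous on $\Theta\times\mathsf X$. (4) There exist a metric $d$ on $\mathsf X$ induced by a norm on $\mathbb R^D$, $\mathbf x_1\in\mathsf X$, a closed set $\mathsf X_1\subseteq\mathsf X$, $\varrho\in(0,1)$, $C\ge0$ and measurable functions $\bar\psi:\mathsf X\to\mathbb R_+$, $H:\mathbb R_+\to\mathbb R_+$, $\bar\phi:\mathsf Y\to\mathbb R_+$ such that: (i) $\psi^\theta_y(\mathbf x)\in\mathsf X_1$ for all $\theta\in\Theta$, $(\mathbf x,y)\in\mathsf X\times\mathsf Y$; (ii) $\sup_{(\theta,\mathbf x,y)\in\Theta\times\mathsf X_1\times\mathsf Y}g^\theta(\mathbf x;y)<\infty$; (iii) for all $\theta\in\Theta$, $n\in\mathbb Z_+$, $\mathbf x\in\mathsf X$, $y_{1:n}\in\mathsf Y^n$, $d\big(\psi^\theta\langle y_{1:n}\rangle(\mathbf x_1),\psi^\theta\langle y_{1:n}\rangle(\mathbf x)\big)\le\varrho^n\,\bar\psi(\mathbf x)$; (iv) $\bar\psi$ is locally bounded; (v) $\bar\psi(\psi^\theta_y(\mathbf x_1))\le\bar\phi(y)$ for all $\theta\in\Theta$, $y\in\mathsf Y$; (vi) for all $\theta\in\Theta$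 and $(\mathbf x,\mathbf x',y)\in\mathsf X_1\times\mathsf X_1\times\mathsf Y$, $\left|\ln\frac{g^\theta(\mathbf x;y)}{g^\theta(\mathbf x';y)}\right|\le H(d(\mathbf x,\mathbf x'))\,e^{C\,(d(\mathbf x_1,\mathbf x)\vee d(\mathbf x_1,\mathbf x'))}\,\bar\phi(y)$; (vii) $H(u)=O(u)$ as $u\to0$; (viii) if $C=0$, then $G^\theta\ln^+\bar\phi\lesssim\bar V$ for all $\theta\in\Theta$; otherwise $G^\theta\bar\phi\lesssim\bar V$ for all $\theta\in\Theta$.
   Context: $\mathbb Z_+=\{0,1,2,\dots\}$, $\mathbb R_+=[0,\infty)$, $\ln^+u=\max(\ln u,0)$ (with $\ln^+0=0$), $a\vee b=\max(a,b)$; vectors are column vectors and $T$ denotes transpose. The observation-driven transition kernel is $K^\theta((\mathbf x,y);d\mathbf x'\,dy')=\delta_{\psi^\theta_y(\mathbf x)}(d\mathbf x')\,G^\theta(\mathbf x';dy')$ on $\mathsf X\times\mathsf Y$. For a nonnegative function $f$ on $\mathsf Y$, $G^\theta f(\mathbf x)=\int f(y)\,G^\theta(\mathbf x;dy)$. For $y_{1:n}=(y_1,\dots,y_n)$, $\psi^\theta\langle y_{1:n}\rangle=\psi^\theta_{y_n}\circ\dots\circ\psi^\theta_{y_1}$, the identity map if $n=0$. For functions $f$ real-valued and $V$ nonnegative on $\mathsf X$, $f\lesssim V$ means there is $c>0$ with $|f(\mathbf x)|\le cV(\mathbf x)$ for all $\mathbf x\in\mathsf X$. *)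

theory Defs
  imports "HOL-Probability.Probability" "HOL-Library.Landau_Symbols"
begin

definition is_norm :: "('a::real_vector \<Rightarrow> real) \<Rightarrow> bool" where
  "is_norm N \<longleftrightarrow>
     (\<forall>x. 0 \<le> N x) \<and> (\<forall>x. N x = 0 \<longleftrightarrow> x = 0) \<and>
     (\<forall>c x. N (c *\<^sub>R x) = \<bar>c\<bar> * N x) \<and> (\<forall>x y. N (x + y) \<le> N x + N y)"

definition metric_from_norm :: "('a::real_vector \<Rightarrow> 'a \<Rightarrow> real) \<Rightarrow> bool" where
  "metric_from_norm d \<longleftrightarrow> (\<exists>N. is_norm N \<and> d = (\<lambda>x x'. N (x - x')))"

text \<open>Eigenvalues of a real matrix are taken in the complex numbers. They form a finite nonempty
  set, so the maximum is well defined.\<close>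

definition eigenvals :: "real^'n^'n \<Rightarrow> complex set" where
  "eigenvals M = {k. \<exists>v::complex^'n. v \<noteq> 0 \<and> (\<chi> i j. complex_of_real (M $ i $ j)) *v v = k *s v}"

definition spec_radius :: "real^'n^'n \<Rightarrow> real" where
  "spec_radius M = Max (cmod ` eigenvals M)"

definition locally_bounded_on :: "'a::topological_space set \<Rightarrow> ('a \<Rightarrow> real) \<Rightarrow> bool" where
  "locally_bounded_on S f \<longleftrightarrow> (\<forall>x\<in>S. \<exists>U. open U \<and> x \<in> U \<and> bounded (f ` (U \<inter> S)))"

definition ln_plus :: "real \<Rightarrow> real" where
  "ln_plus u = (if u = 0 then 0 else max (ln u) 0)"

text \<open>Kernel action on nonnegative functions; the value may be infinite. The bound
  in \<open>dominated_on\<close> forces it to be finite on \<open>S\<close>.\<close>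

definition kernel_int :: "('x \<Rightarrow> 'y measure) \<Rightarrow> ('y \<Rightarrow> real) \<Rightarrow> 'x \<Rightarrow> ennreal" where
  "kernel_int G f x = (\<integral>\<^sup>+ y. ennreal (f y) \<partial>G x)"

definition dominated_on :: "'x set \<Rightarrow> ('x \<Rightarrow> ennreal) \<Rightarrow> ('x \<Rightarrow> real) \<Rightarrow> bool" where
  "dominated_on S f V \<longleftrightarrow> (\<exists>c>0. \<forall>x\<in>S. f x \<le> ennreal (c * V x))"

text \<open>From \<open>(x, y)\<close>, move to \<open>x' = \<psi> y x\<close>, then draw \<open>y'\<close> from \<open>G x'\<close>.\<close>

definition od_kernel ::
  "'x measure \<Rightarrow> 'y measure \<Rightarrow> ('y \<Rightarrow> 'x \<Rightarrow> 'x) \<Rightarrow> ('x \<Rightarrow> 'y measure) \<Rightarrow> 'x \<times> 'y \<Rightarrow> ('x \<times> 'y) measure"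
where
  "od_kernel MX MY \<psi> G =
     (\<lambda>(x, y). return MX (\<psi> y x) \<bind> (\<lambda>x'. G x' \<bind> (\<lambda>y'. return (MX \<Otimes>\<^sub>M MY) (x', y'))))"

definition stationary_distribution :: "'a measure \<Rightarrow> ('a \<Rightarrow> 'a measure) \<Rightarrow> 'a measure \<Rightarrow> bool" where
  "stationary_distribution S K \<pi> \<longleftrightarrow> prob_space \<pi> \<and> sets \<pi> = sets S \<and> \<pi> \<bind> K = \<pi>"

type_synonym 'n param = "(real^'n) \<times> (real^'n) \<times> (real^'n^'n) \<times> (real^'n)"

definition posvecs :: "(real^'n) set" where
  "posvecs = {x. \<forall>i. 0 < x $ i}"

definition nonnegvecs :: "(real^'n) set" where
  "nonnegvecs = {x. \<forall>i. 0 \<le> x $ i}"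

definition simplex_weights :: "(real^'n) set" where
  "simplex_weights = {\<gamma> \<in> nonnegvecs. (\<Sum>l\<in>UNIV. \<gamma> $ l) = 1}"

definition param_space :: "'n::finite param set" where
  "param_space = simplex_weights \<times> posvecs \<times> {A. \<forall>i j. 0 \<le> A $ i $ j} \<times> nonnegvecs"

definition state_measure :: "(real^'n) measure" where
  "state_measure = restrict_space borel posvecs"

definition nm_psi :: "'n::finite param \<Rightarrow> real \<Rightarrow> real^'n \<Rightarrow> real^'n" where
  "nm_psi = (\<lambda>(\<gamma>, \<omega>, A, b) y x. \<omega> + A *v x + y\<^sup>2 *\<^sub>R b)"

text \<open>\<open>fold\<close> applies the map of the head of the list first.\<close>

definition nm_psi_iter :: "'n::finite param \<Rightarrow> real list \<Rightarrow> real^'n \<Rightarrow> real^'n" where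
  "nm_psi_iter \<theta> ys = fold (nm_psi \<theta>) ys"

definition nm_g :: "'n::finite param \<Rightarrow> real^'n \<Rightarrow> real \<Rightarrow> real" where
  "nm_g = (\<lambda>(\<gamma>, \<omega>, A, b) x y.
     \<Sum>l\<in>UNIV. \<gamma> $ l * (exp (- (y\<^sup>2 / (2 * x $ l))) / sqrt (2 * pi * x $ l)))"

definition nm_G :: "'n::finite param \<Rightarrow> real^'n \<Rightarrow> real measure" where
  "nm_G \<theta> x = density lborel (\<lambda>y. ennreal (nm_g \<theta> x y))"

definition nm_K :: "'n::finite param \<Rightarrow> (real^'n) \<times> real \<Rightarrow> ((real^'n) \<times> real) measure" where
  "nm_K \<theta> = od_kernel state_measure borel (nm_psi \<theta>) (nm_G \<theta>)"

definition outer_prod :: "real^'n \<Rightarrow> real^'n \<Rightarrow> real^'n^'n" where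
  "outer_prod b \<gamma> = (\<chi> i j. b $ i * \<gamma> $ j)"

end

theory Submission
  imports Defs "HOL-Computational_Algebra.Polynomial"
begin

text \<open>The observation density is a Gaussian scale mixture, so an observation from state \<open>x\<close> is
\<open>y = sqrt (x $ l) * \<epsilon>\<close>, where the component \<open>l\<close> has law \<open>\<gamma>\<close> and \<open>\<epsilon>\<close> is an independent standard
normal variable. Substituting this into the state update turns the chain into an affine
recursion with independent, identically distributed, nonnegative coefficients,
\<open>x' = \<omega> + (A + \<epsilon>\<^sup>2 b e\<^sub>l\<^sup>T) x\<close>, whose mean matrix is \<open>A + b \<gamma>\<^sup>T\<close>.

A nonnegative matrix \<open>M\<close> with spectral radius below one has a strictly positive \<open>w\<close> with
\<open>w\<^sup>T M \<le> \<rho> w\<^sup>T\<close> for some \<open>\<rho> < 1\<close> (\<open>positive_left_subsolution_strict\<close>). In the weighted norm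
\<open>\<Sum>\<^sub>i w\<^sub>i \<bar>x\<^sub>i\<bar>\<close> two copies of the recursion driven by the same noise therefore approach each other
in mean by the factor \<open>\<rho>\<close> at every step. This forces invariant laws to integrate
bounded Lipschitz functions alike (\<open>invariant_unique\<close>). Iterating the recursion backwards along a
noise stream gives an increasing sequence with bounded weighted mean, and the law of its limit is
invariant with a finite first moment (\<open>invariant_limit_state\<close>, \<open>nn_integral_wnorm_limit_state\<close>).
Stationary laws of the kernel on states and observations correspond to invariant laws of the
recursion (\<open>stationary_nm_K_iff\<close>).

For the conditions that are uniform in the parameter, the inequality \<open>w\<^sup>T (A + b \<gamma>\<^sup>T) < \<rho> w\<^sup>T\<close> is open
in the parameter, so by compactness finitely many pairs \<open>(w, \<rho>)\<close> serve the whole set. Since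
\<open>A \<le> A + b \<gamma>\<^sup>T\<close> entrywise, they bound the powers of \<open>A\<close>, which are exactly the differences of the
iterated updates (\<open>uniform_contraction\<close>, \<open>nm_psi_iter_diff\<close>). After one update every coordinate of
the state is at least the smallest intercept \<open>m\<close>, and there the log density is Lipschitz in the state
with a constant growing like \<open>1 + y\<^sup>2\<close> (\<open>ln_nm_g_ratio_le\<close>). Hence \<open>C = 0\<close> and \<open>1 + y\<^sup>2\<close> as the
bounding function of the observation suffice. The norm \<open>V\<close> is small near the origin, so the
positive logarithm of this function has to vanish at \<open>y = 0\<close>; it does, since \<open>ln (1 + y\<^sup>2) \<le> y\<^sup>2\<close>, whose mean
\<open>\<Sum>\<^sub>l \<gamma>\<^sub>l x\<^sub>l\<close> is dominated by \<open>V\<close>. All remaining constants are absorbed by scaling the metric.\<close>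

section \<open>Positive left subsolutions of nonnegative matrices\<close>

text \<open>\<^const>\<open>spec_radius\<close> is a \<^const>\<open>Max\<close>, which bounds the eigenvalues only if there are finitely many.
They are the roots of the characteristic polynomial; it is not the zero polynomial because
the eigenvalues are bounded by the operator norm.\<close>

lemma finite_eigenvals:
  fixes M :: "real^'n::finite^'n"
  shows "finite (eigenvals M)"
proof -
  let ?C = "(\<chi> i j. complex_of_real (M $ i $ j)) :: complex^'n^'n"
  define D where "D k = ?C - mat k" for k :: complex
  define p where "p = (\<Sum>q | q permutes (UNIV::'n set). of_int (sign q) *
     (\<Prod>i\<in>UNIV. if q i = i then [: ?C $ i $ i, -1 :] else [: ?C $ i $ q i :]))"
  have p: "poly p k = det (D k)" for k
    unfolding p_def det_def poly_sum poly_mult poly_prod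
    by (intro sum.cong refl arg_cong2[where f="(*)"] prod.cong) (auto simp: D_def mat_def)
  have ev: "k \<in> eigenvals M \<longleftrightarrow> det (D k) = 0" for k
  proof -
    have "D k *v v = ?C *v v - k *s v" for v
      by (simp add: D_def matrix_vector_mult_diff_rdistrib mat_def vec_eq_iff matrix_vector_mult_def
        vector_scalar_mult_def if_distrib[where f="\<lambda>x. x * _"] sum_subtractf left_diff_distrib cong: if_cong)
    then have "k \<in> eigenvals M \<longleftrightarrow> (\<exists>v. v \<noteq> 0 \<and> D k *v v = 0)"
      by (auto simp: eigenvals_def)
    also have "\<dots> \<longleftrightarrow> det (D k) = 0"
      using invertible_det_nz[of "D k"] matrix_left_invertible_ker[of "D k"]
        invertible_left_inverse[of "D k"] by blast
    finally show ?thesis .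
  qed
  have bdd: "\<exists>B. \<forall>k\<in>eigenvals M. cmod k \<le> B"
  proof -
    have "linear ((*v) ?C)"
      by (simp add: linear_iff matrix_vector_right_distrib)
         (simp add: vec_eq_iff matrix_vector_mult_def scaleR_sum_right)
    then have "bounded_linear ((*v) ?C)" by (rule linear_conv_bounded_linear[THEN iffD1])
    then obtain B where B: "\<And>v. norm (?C *v v) \<le> norm v * B"
      using bounded_linear.bounded by blast
    { fix k assume "k \<in> eigenvals M"
      then obtain v where v: "v \<noteq> 0" "?C *v v = k *s v" by (auto simp: eigenvals_def)
      have "norm (k *s v) = cmod k * norm v"
        by (simp add: norm_vec_def L2_set_def norm_mult power_mult_distrib sum_distrib_left[symmetric] real_sqrt_mult)
      with B[of v] v have "cmod k \<le> B" by (simp add: mult.commute) }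
    then show ?thesis by blast
  qed
  then obtain B where B: "\<And>k. k \<in> eigenvals M \<Longrightarrow> cmod k \<le> B" by blast
  have "poly p (of_real (\<bar>B\<bar> + 1)) \<noteq> 0"
    using B[of "of_real (\<bar>B\<bar> + 1)"] by (auto simp: p ev)
  then have "p \<noteq> 0" by auto
  then have "finite {k. poly p k = 0}" by (rule poly_roots_finite)
  then show ?thesis by (auto simp: p ev[symmetric] elim: rev_finite_subset)
qed

lemma real_eigenvalue_le_spec_radius:
  fixes M :: "real^'n::finite^'n"
  assumes "v \<noteq> 0" "M *v v = t *\<^sub>R v"
  shows "t \<le> spec_radius M"
proof -
  have "(\<chi> i j. complex_of_real (M $ i $ j)) *v (\<chi> i. complex_of_real (v $ i))
      = complex_of_real t *s (\<chi> i. complex_of_real (v $ i))"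
    using assms(2) by (simp add: vec_eq_iff matrix_vector_mult_def flip: of_real_mult of_real_sum)
  moreover have "(\<chi> i. complex_of_real (v $ i)) \<noteq> 0" using assms(1) by (auto simp: vec_eq_iff)
  ultimately have "complex_of_real t \<in> eigenvals M" unfolding eigenvals_def by blast
  then have "cmod (complex_of_real t) \<le> spec_radius M"
    unfolding spec_radius_def by (intro Max_ge finite_imageI finite_eigenvals imageI)
  then show ?thesis by simp
qed

text \<open>For real \<open>t \<ge> 1\<close> the matrix \<open>t I - M\<close> is invertible, so \<open>w\<^sup>T (t I - M) = 1\<^sup>T\<close> has a solution \<open>W t\<close> that
depends continuously on \<open>t\<close>. The identity \<open>t w\<^sub>j = 1 + (w\<^sup>T M)\<^sub>j\<close> shows that a nonnegative solution is
strictly positive. Hence the set of \<open>t\<close> with a nonnegative solution is open and closed in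
\<open>[1, \<infinity>)\<close>; it contains all large \<open>t\<close>, so it contains \<open>t = 1\<close>. This is a connectedness substitute for
the Perron--Frobenius theorem.\<close>

lemma positive_left_subsolution:
  fixes M :: "real^'n::finite^'n"
  assumes nonneg: "\<And>i j. 0 \<le> M $ i $ j" and "spec_radius M < 1"
  obtains w :: "real^'n" where "\<And>i. 0 < w $ i" "\<And>j. (\<Sum>i\<in>UNIV. w $ i * M $ i $ j) < w $ j"
proof -
  define R where "R t = mat t - transpose M" for t :: real
  have R_mult: "(R t *v w) $ j = t * w $ j - (\<Sum>i\<in>UNIV. w $ i * M $ i $ j)" for t w j
    by (simp add: R_def matrix_vector_mult_diff_rdistrib mat_def matrix_vector_mult_def transpose_def
      mult.commute[of _ "w $ _"] right_diff_distrib sum_subtractf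
      if_distrib[where f="\<lambda>x. _ * x"] cong: if_cong)
  have det: "det (R t) \<noteq> 0" if "1 \<le> t" for t
  proof
    assume "det (R t) = 0"
    moreover have "transpose (R t) = mat t - M"
      by (auto simp: R_def transpose_def vec_eq_iff mat_def)
    ultimately have "det (mat t - M) = 0" by (metis det_transpose)
    then obtain v where "v \<noteq> 0" "(mat t - M) *v v = 0"
      using invertible_det_nz[of "mat t - M"] matrix_left_invertible_ker[of "mat t - M"]
        invertible_left_inverse[of "mat t - M"] by blast
    moreover have "mat t *v v = t *\<^sub>R v"
      by (simp add: vec_eq_iff matrix_vector_mult_def mat_def if_distrib[where f="\<lambda>x. x * _"] cong: if_cong)
    ultimately have "t \<le> spec_radius M"
      by (intro real_eigenvalue_le_spec_radius[of v]) (auto simp: matrix_vector_mult_diff_rdistrib)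
    with that assms(2) show False by simp
  qed
  \<comment> \<open>Cramer's rule makes the continuity in \<open>t\<close> visible.\<close>
  define W where "W t = (\<chi> k. det (\<chi> i j. if j = k then 1 else R t $ i $ j) / det (R t))" for t
  have W: "R t *v W t = 1" if "1 \<le> t" for t
    using cramer[OF det[OF that], of "W t" 1] by (simp add: W_def cong del: if_weak_cong)
  have W': "t * W t $ j = 1 + (\<Sum>i\<in>UNIV. W t $ i * M $ i $ j)" if "1 \<le> t" for t j
    using R_mult[of t "W t" j] W[OF that] by simp
  have R_cont: "continuous_on {1..} (\<lambda>t. R t $ i $ j)" for i j
    by (cases "i = j") (auto simp: R_def mat_def intro!: continuous_intros)
  have cont: "continuous_on {1..} (\<lambda>t. W t $ k)" for k
    unfolding W_def vec_lambda_beta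
  proof (intro continuous_on_divide)
    show "continuous_on {1..} (\<lambda>t. det (R t))"
      unfolding det_def by (intro continuous_intros R_cont)
    have "continuous_on {1..} (\<lambda>t. if j = k then 1 else R t $ i $ j)" for i j
      by (cases "j = k") (simp_all add: R_cont)
    then show "continuous_on {1..} (\<lambda>t. det (\<chi> i j. if j = k then 1 else R t $ i $ j))"
      unfolding det_def by (intro continuous_intros) simp
  qed (use det in auto)
  define T where "T = {t \<in> {1..}. \<forall>k. 0 \<le> W t $ k}"
  have pos: "0 < W t $ k" if "t \<in> T" for t k
  proof -
    have "0 < t * W t $ k"
      using that nonneg W'[of t k] by (auto simp: T_def intro!: add_pos_nonneg sum_nonneg)
    with that show ?thesis by (auto simp: T_def zero_less_mult_iff)
  qed
  have "openin (top_of_set {1..}) (\<Inter>k. {1..} \<inter> (\<lambda>t. W t $ k) -` {0<..})"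
    by (intro openin_INT2 continuous_openin_preimage_gen cont) auto
  also have "(\<Inter>k. {1..} \<inter> (\<lambda>t. W t $ k) -` {0<..}) = T"
    using pos by (auto simp: T_def less_imp_le)
  finally have open_T: "openin (top_of_set {1..}) T" .
  have "closedin (top_of_set {1..}) (\<Inter>k. {1..} \<inter> (\<lambda>t. W t $ k) -` {0..})"
    by (intro closedin_INT continuous_closedin_preimage cont) auto
  also have "(\<Inter>k. {1..} \<inter> (\<lambda>t. W t $ k) -` {0..}) = T"
    by (auto simp: T_def)
  finally have closed_T: "closedin (top_of_set {1..}) T" .
  have "T \<noteq> {}"
  proof -
    \<comment> \<open>Once \<open>t\<close> exceeds every column sum of \<open>M\<close>, a negative minimal coordinate \<open>m\<close> would give
    \<open>t m \<ge> 1 + m S\<close>, which is impossible.\<close>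
    define S where "S = (\<Sum>i\<in>UNIV. \<Sum>j\<in>UNIV. M $ i $ j)"
    have S: "(\<Sum>i\<in>UNIV. M $ i $ j) \<le> S" for j
      unfolding S_def by (intro sum_mono member_le_sum) (auto intro: nonneg)
    have "0 \<le> S" unfolding S_def by (intro sum_nonneg nonneg)
    define t where "t = S + 1"
    have t: "1 \<le> t" using \<open>0 \<le> S\<close> by (simp add: t_def)
    define m where "m = Min (range (\<lambda>k. W t $ k))"
    have m_le: "m \<le> W t $ k" for k unfolding m_def by (intro Min_le) auto
    have "m \<in> range (\<lambda>k. W t $ k)" unfolding m_def by (intro Min_in) auto
    then obtain j where j: "m = W t $ j" by (rule rangeE)
    have "0 \<le> m"
    proof (rule ccontr)
      assume "\<not> 0 \<le> m"
      then have "m < 0" by simp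
      have "(\<Sum>i\<in>UNIV. m * M $ i $ j) \<le> (\<Sum>i\<in>UNIV. W t $ i * M $ i $ j)"
        by (intro sum_mono mult_right_mono m_le nonneg)
      moreover have "m * S \<le> m * (\<Sum>i\<in>UNIV. M $ i $ j)"
        using S[of j] \<open>m < 0\<close> by (simp add: mult_left_mono_neg)
      ultimately have "1 + m * S \<le> t * m"
        using W'[OF t, of j] by (simp add: j sum_distrib_left)
      then show False using \<open>m < 0\<close> by (simp add: t_def algebra_simps)
    qed
    then have "0 \<le> W t $ k" for k using m_le[of k] by linarith
    then have "t \<in> T" using t by (simp add: T_def)
    then show ?thesis by blast
  qed
  then have "T = {1..}"
    using connected_clopen[THEN iffD1, OF connected_Ici] open_T closed_T by blast
  then have "1 \<in> T" by simp
  show ?thesis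
  proof (rule that)
    show "0 < W 1 $ i" for i by (rule pos) fact
    show "(\<Sum>i\<in>UNIV. W 1 $ i * M $ i $ j) < W 1 $ j" for j
      using W'[of 1 j] by linarith
  qed
qed

text \<open>The room between \<open>\<rho> < 1\<close> and the strict inequality is what makes the condition stable
under small perturbations of the matrix.\<close>

lemma positive_left_subsolution_strict:
  fixes M :: "real^'n::finite^'n"
  assumes "\<And>i j. 0 \<le> M $ i $ j" and "spec_radius M < 1"
  obtains w :: "real^'n" and \<rho> where "\<And>i. 0 < w $ i" "0 < \<rho>" "\<rho> < 1"
    "\<And>j. (\<Sum>i\<in>UNIV. w $ i * M $ i $ j) < \<rho> * w $ j"
proof -
  obtain w :: "real^'n" where w: "\<And>i. 0 < w $ i" "\<And>j. (\<Sum>i\<in>UNIV. w $ i * M $ i $ j) < w $ j"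
    using positive_left_subsolution assms by blast
  define q where "q j = (\<Sum>i\<in>UNIV. w $ i * M $ i $ j) / w $ j" for j
  define r where "r = Max (insert 0 (range q))"
  have "r \<in> insert 0 (range q)" unfolding r_def by (rule Max_in) auto
  moreover have "q j < 1" for j using w by (simp add: q_def)
  ultimately have "r < 1" by auto
  have "0 \<le> r" unfolding r_def by (rule Max_ge) auto
  have "q j < (1 + r) / 2" for j
  proof -
    have "q j \<le> r" unfolding r_def by (rule Max_ge) auto
    with \<open>r < 1\<close> show ?thesis by simp
  qed
  then have "(\<Sum>i\<in>UNIV. w $ i * M $ i $ j) < (1 + r) / 2 * w $ j" for j
    using w(1)[of j] unfolding q_def by (simp add: divide_less_eq)
  then show ?thesis
    using w(1) \<open>r < 1\<close> \<open>0 \<le> r\<close> by (intro that[of w "(1 + r) / 2"]) auto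
qed

section \<open>Affine recursions with random nonnegative coefficients\<close>

lemma borel_measurable_vecI:
  fixes f :: "'a \<Rightarrow> real^'n::finite"
  assumes "\<And>i. (\<lambda>x. f x $ i) \<in> borel_measurable M"
  shows "f \<in> borel_measurable M"
  by (subst borel_measurable_euclidean_space) (auto simp: Basis_vec_def inner_axis assms)

lemma measurable_vec_nth [measurable (raw)]:
  fixes f :: "'a \<Rightarrow> real^'n::finite"
  assumes "f \<in> borel_measurable M"
  shows "(\<lambda>x. f x $ i) \<in> borel_measurable M"
  using measurable_compose[OF assms borel_measurable_nth] .

lemma space_state_measure [simp]: "space state_measure = posvecs"
  by (simp add: state_measure_def space_restrict_space)

lemma measurable_state_measureI:
  "f \<in> borel_measurable M \<Longrightarrow> (\<And>x. x \<in> space M \<Longrightarrow> f x \<in> posvecs) \<Longrightarrow> f \<in> M \<rightarrow>\<^sub>M state_measure"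
  unfolding state_measure_def by (rule measurable_restrict_space2) auto

lemma measurable_state_borel: "f \<in> M \<rightarrow>\<^sub>M state_measure \<Longrightarrow> f \<in> borel_measurable M"
  unfolding state_measure_def
  using measurable_compose[OF _ measurable_restrict_space1[OF measurable_ident]] by (auto simp: id_def)

lemma borel_measurable_state_measure:
  "f \<in> borel_measurable borel \<Longrightarrow> f \<in> borel_measurable state_measure"
  unfolding state_measure_def by (rule measurable_restrict_space1)

lemma sigma_sets_UNIV_closed:
  "sets (sigma UNIV (Collect closed)) = sigma_sets UNIV (Collect closed)" by simp

lemma posvecs_borel: "(posvecs :: (real^'n::finite) set) \<in> sets borel"
proof -
  have "(posvecs :: (real^'n) set) = (\<Inter>i. {x. 0 < x $ i})" by (auto simp: posvecs_def)
  moreover have "open (\<Inter>i. {x :: real^'n. 0 < x $ i})"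
    by (intro open_INT open_Collect_less continuous_intros ballI) auto
  ultimately show ?thesis by simp
qed

text \<open>The indicator of a closed set is the decreasing limit of the Lipschitz functions
\<open>max 0 (1 - k * infdist x C)\<close>, and the traces of closed sets on \<^const>\<open>posvecs\<close> generate its Borel sets.\<close>

lemma prob_eqI_lipschitz:
  fixes \<mu> \<nu> :: "(real^'n::finite) measure"
  assumes "prob_space \<mu>" "prob_space \<nu>"
    and sets: "sets \<mu> = sets state_measure" "sets \<nu> = sets state_measure"
    and eq: "\<And>f L. (\<And>x. 0 \<le> f x) \<Longrightarrow> (\<And>x. f x \<le> 1) \<Longrightarrow> (\<And>x y. \<bar>f x - f y\<bar> \<le> L * norm (x - y)) \<Longrightarrow>
      0 \<le> L \<Longrightarrow> (\<integral>x. f x \<partial>\<mu>) = (\<integral>x. f x \<partial>\<nu>)"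
  shows "\<mu> = \<nu>"
proof -
  interpret \<mu>: prob_space \<mu> by fact
  interpret \<nu>: prob_space \<nu> by fact
  have space: "space \<mu> = posvecs" "space \<nu> = posvecs" using sets[THEN sets_eq_imp_space_eq] by simp_all
  have ms: "f \<in> borel_measurable \<mu> \<longleftrightarrow> f \<in> borel_measurable state_measure"
     "f \<in> borel_measurable \<nu> \<longleftrightarrow> f \<in> borel_measurable state_measure" for f :: "real^'n \<Rightarrow> real"
    using measurable_cong_sets[OF sets(1) refl] measurable_cong_sets[OF sets(2) refl] by blast+
  let ?g = "\<lambda>(C::(real^'n) set) (k::nat) x. max 0 (1 - real k * infdist x C)"
  have lim: "(\<lambda>k. \<integral>x. ?g C k x \<partial>M) \<longlonglongrightarrow> measure M (C \<inter> posvecs)"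
    if C: "closed C" "C \<noteq> {}" and M: "prob_space M" "sets M = sets state_measure" for C M
  proof -
    interpret prob_space M by fact
    have sM: "space M = posvecs" using sets_eq_imp_space_eq[OF M(2)] by simp
    have meas: "f \<in> borel_measurable M" if "f \<in> borel_measurable borel" for f :: "real^'n \<Rightarrow> real"
      using borel_measurable_state_measure[OF that] measurable_cong_sets[OF M(2) refl] by blast
    have "(\<lambda>k. \<integral>x. ?g C k x \<partial>M) \<longlonglongrightarrow> (\<integral>x. indicat_real C x \<partial>M)"
    proof (rule integral_dominated_convergence[where w="\<lambda>_. 1"])
      show "(indicator C :: _ \<Rightarrow> real) \<in> borel_measurable M" using C by (intro meas) auto
      show "?g C k \<in> borel_measurable M" for k
        by (intro meas borel_measurable_continuous_onI continuous_intros)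
      show "AE x in M. norm (?g C k x) \<le> 1" for k by (auto simp: infdist_nonneg)
      show "AE x in M. (\<lambda>k. ?g C k x) \<longlonglongrightarrow> indicator C x"
      proof (rule AE_I2)
        fix x
        show "(\<lambda>k. ?g C k x) \<longlonglongrightarrow> indicator C x"
        proof (cases "x \<in> C")
          case True then show ?thesis by simp
        next
          case False
          then have "0 < infdist x C"
            using C infdist_pos_not_in_closed by blast
          have "\<forall>\<^sub>F k in sequentially. nat \<lceil>1 / infdist x C\<rceil> < k"
            by (rule eventually_gt_at_top)
          then have "\<forall>\<^sub>F k in sequentially. ?g C k x = 0"
          proof eventually_elim
            case (elim k)
            then have "1 / infdist x C \<le> real k" by linarith
            then have "1 \<le> real k * infdist x C" using \<open>0 < infdist x C\<close> by (simp add: field_simps)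
            then show ?case by simp
          qed
          then show ?thesis using False by (simp add: tendsto_eventually)
        qed
      qed
    qed simp
    also have "(\<integral>x. indicat_real C x \<partial>M) = measure M (C \<inter> posvecs)"
      using M(2) by (simp add: sM)
    finally show ?thesis .
  qed
  have int: "(\<integral>x. ?g C k x \<partial>\<mu>) = (\<integral>x. ?g C k x \<partial>\<nu>)" if "C \<noteq> {}" for C k
  proof (rule eq)
    fix x y
    have "\<bar>infdist x C - infdist y C\<bar> \<le> norm (x - y)"
      using infdist_triangle_abs[of x C y] by (simp add: dist_norm)
    then have "real k * \<bar>infdist x C - infdist y C\<bar> \<le> real k * norm (x - y)"
      by (intro mult_left_mono) auto
    moreover have "\<bar>?g C k x - ?g C k y\<bar> \<le> \<bar>real k * infdist x C - real k * infdist y C\<bar>" by linarith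
    ultimately show "\<bar>?g C k x - ?g C k y\<bar> \<le> real k * norm (x - y)"
      by (simp add: abs_mult flip: right_diff_distrib)
  qed (auto simp: infdist_nonneg)
  have closed_eq: "emeasure \<mu> (C \<inter> posvecs) = emeasure \<nu> (C \<inter> posvecs)" if "closed C" for C
  proof (cases "C = {}")
    case False
    have "measure \<mu> (C \<inter> posvecs) = measure \<nu> (C \<inter> posvecs)"
      using lim[OF that False assms(1) sets(1)] lim[OF that False assms(2) sets(2)]
      by (simp add: int[OF False] LIMSEQ_unique)
    then show ?thesis by (simp add: \<mu>.emeasure_eq_measure \<nu>.emeasure_eq_measure)
  qed simp
  let ?E = "(\<inter>) (posvecs :: (real^'n) set) ` Collect closed"
  have sE: "sets (state_measure :: (real^'n) measure) = sigma_sets posvecs ?E"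
    unfolding state_measure_def sets_restrict_space borel_eq_closed
    using posvecs_borel unfolding borel_eq_closed sigma_sets_UNIV_closed by (rule sigma_sets_Int) simp
  show ?thesis
  proof (rule measure_eqI_generator_eq[where E="?E" and \<Omega>=posvecs and A="\<lambda>_. posvecs"])
    show "Int_stable ?E"
    proof (rule Int_stableI)
      fix a b assume "a \<in> ?E" "b \<in> ?E"
      then obtain C D where CD: "closed C" "closed D" "a = posvecs \<inter> C" "b = posvecs \<inter> D" by blast
      then have "a \<inter> b = posvecs \<inter> (C \<inter> D)" by blast
      with CD show "a \<inter> b \<in> ?E" by (simp add: closed_Int)
    qed
    show "emeasure \<mu> X = emeasure \<nu> X" if "X \<in> ?E" for X
      using that closed_eq by (auto simp: Int_commute[of posvecs])
    show "range (\<lambda>_. posvecs) \<subseteq> ?E" by (auto intro!: image_eqI[of _ _ UNIV])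
  qed (auto simp: sets sE)
qed

definition wnorm :: "real^'n::finite \<Rightarrow> real^'n \<Rightarrow> real" where
  "wnorm w x = (\<Sum>i\<in>UNIV. w $ i * \<bar>x $ i\<bar>)"

lemma borel_measurable_wnorm [measurable]: "wnorm w \<in> borel_measurable borel"
  unfolding wnorm_def[abs_def] by measurable

lemma wnorm_nonneg: "(\<And>i. 0 < w $ i) \<Longrightarrow> 0 \<le> wnorm w x"
  unfolding wnorm_def by (intro sum_nonneg mult_nonneg_nonneg) (auto intro: less_imp_le)

lemma wnorm_add_le: "(\<And>i. 0 < w $ i) \<Longrightarrow> wnorm w (x + y) \<le> wnorm w x + wnorm w y"
  unfolding wnorm_def sum.distrib[symmetric] distrib_left[symmetric]
  by (intro sum_mono) (auto intro!: mult_left_mono abs_triangle_ineq less_imp_le)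

text \<open>A nonnegative matrix acts on \<^const>\<open>wnorm\<close> through the left products \<open>w\<^sup>T M\<close> alone, which is why a
left subsolution yields a contraction.\<close>

lemma wnorm_matrix_vector_mult_le:
  fixes M :: "real^'n::finite^'n"
  assumes w: "\<And>i. 0 < w $ i" and M: "\<And>i j. 0 \<le> M $ i $ j"
  shows "wnorm w (M *v x) \<le> (\<Sum>j\<in>UNIV. (\<Sum>i\<in>UNIV. w $ i * M $ i $ j) * \<bar>x $ j\<bar>)"
proof -
  have "wnorm w (M *v x) \<le> (\<Sum>i\<in>UNIV. w $ i * (\<Sum>j\<in>UNIV. M $ i $ j * \<bar>x $ j\<bar>))"
    unfolding wnorm_def matrix_vector_mult_def
    using M w by (intro sum_mono mult_left_mono) (auto intro!: sum_abs[THEN order_trans] sum_mono simp: abs_mult less_imp_le)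
  also have "\<dots> = (\<Sum>i\<in>UNIV. \<Sum>j\<in>UNIV. w $ i * M $ i $ j * \<bar>x $ j\<bar>)"
    by (simp add: sum_distrib_left mult.assoc)
  also have "\<dots> = (\<Sum>j\<in>UNIV. (\<Sum>i\<in>UNIV. w $ i * M $ i $ j) * \<bar>x $ j\<bar>)"
    by (subst sum.swap) (simp add: sum_distrib_right)
  finally show ?thesis .
qed

lemma norm_le_wnorm:
  fixes w :: "real^'n::finite"
  assumes "\<And>i. 0 < w $ i"
  obtains c where "0 < c" "\<And>x. norm x \<le> c * wnorm w x"
proof
  let ?m = "Min (range (\<lambda>i. w $ i))"
  have "?m \<in> range (\<lambda>i. w $ i)" by (intro Min_in) auto
  then show "0 < 1 / ?m" using assms by auto
  then have m: "0 < ?m" by simp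
  fix x :: "real^'n"
  have "norm x * ?m \<le> (\<Sum>i\<in>UNIV. \<bar>x $ i\<bar>) * ?m"
    by (intro mult_right_mono norm_le_l1_cart less_imp_le[OF m])
  also have "\<dots> = (\<Sum>i\<in>UNIV. ?m * \<bar>x $ i\<bar>)" by (simp add: sum_distrib_left mult.commute)
  also have "\<dots> \<le> wnorm w x"
    unfolding wnorm_def by (intro sum_mono mult_right_mono) auto
  finally show "norm x \<le> 1 / ?m * wnorm w x" using m by (simp add: field_simps)
qed

lemma wnorm_le_norm:
  fixes w :: "real^'n::finite"
  assumes "\<And>i. 0 < w $ i"
  shows "wnorm w x \<le> (\<Sum>i\<in>UNIV. w $ i) * norm x"
  unfolding wnorm_def sum_distrib_right
  by (intro sum_mono mult_left_mono component_le_norm_cart less_imp_le[OF assms])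

text \<open>The last assumption bounds the mean of \<open>w\<^sup>T N\<close> by \<open>\<rho> w\<^sup>T\<close>. It is phrased with a nonnegative
integral so that it contains the integrability of the coefficients.\<close>

locale positive_affine_recursion = prob_space P for P :: "'e measure" +
  fixes N :: "'e \<Rightarrow> real^'n::finite^'n" and \<omega> w :: "real^'n" and \<rho> :: real
  assumes N_measurable [measurable]: "\<And>i j. (\<lambda>e. N e $ i $ j) \<in> borel_measurable P"
    and N_nonneg: "\<And>e i j. 0 \<le> N e $ i $ j"
    and \<omega>_pos: "\<And>i. 0 < \<omega> $ i"
    and w_pos: "\<And>i. 0 < w $ i"
    and \<rho>: "0 \<le> \<rho>" "\<rho> < 1"
    and contraction: "\<And>j. (\<integral>\<^sup>+e. ennreal (\<Sum>i\<in>UNIV. w $ i * N e $ i $ j) \<partial>P) \<le> ennreal (\<rho> * w $ j)"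
begin

definition step :: "real^'n \<Rightarrow> 'e \<Rightarrow> real^'n" where
  "step x e = \<omega> + N e *v x"

text \<open>Invariance is expressed by one step of the recursion with independent noise, so that integrals
against an invariant law are integrals over the product with the noise.\<close>

definition invariant :: "(real^'n) measure \<Rightarrow> bool" where
  "invariant \<mu> \<longleftrightarrow> prob_space \<mu> \<and> sets \<mu> = sets state_measure \<and>
     distr (\<mu> \<Otimes>\<^sub>M P) state_measure (\<lambda>(x, e). step x e) = \<mu>"

lemma step_ge: "(\<And>i. 0 \<le> x $ i) \<Longrightarrow> \<omega> $ i \<le> step x e $ i"
  by (auto simp: step_def matrix_vector_mult_def intro!: sum_nonneg mult_nonneg_nonneg N_nonneg)

lemma step_posvecs: "x \<in> posvecs \<Longrightarrow> step x e \<in> posvecs"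
  unfolding posvecs_def mem_Collect_eq
  by (intro allI less_le_trans[OF \<omega>_pos step_ge] less_imp_le) blast

lemma step_mono: "(\<And>i. x $ i \<le> y $ i) \<Longrightarrow> step x e $ i \<le> step y e $ i"
  by (auto simp: step_def matrix_vector_mult_def intro!: sum_mono mult_left_mono N_nonneg)

lemma measurable_step [measurable (raw)]:
  assumes [measurable]: "f \<in> borel_measurable M" "g \<in> M \<rightarrow>\<^sub>M P"
  shows "(\<lambda>z. step (f z) (g z)) \<in> borel_measurable M"
proof (rule borel_measurable_vecI)
  fix i
  have [measurable]: "(\<lambda>z. N (g z) $ i $ j) \<in> borel_measurable M" for j
    using measurable_compose[OF assms(2) N_measurable] .
  show "(\<lambda>z. step (f z) (g z) $ i) \<in> borel_measurable M"
    unfolding step_def matrix_vector_mult_def vector_add_component vec_lambda_beta by measurable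
qed

lemma nn_integral_wnorm_le:
  "(\<integral>\<^sup>+e. ennreal (wnorm w (N e *v x)) \<partial>P) \<le> ennreal (\<rho> * wnorm w x)"
proof -
  have "(\<integral>\<^sup>+e. ennreal (wnorm w (N e *v x)) \<partial>P)
    \<le> (\<integral>\<^sup>+e. ennreal (\<Sum>j\<in>UNIV. (\<Sum>i\<in>UNIV. w $ i * N e $ i $ j) * \<bar>x $ j\<bar>) \<partial>P)"
    by (intro nn_integral_mono ennreal_leI wnorm_matrix_vector_mult_le w_pos N_nonneg)
  also have "\<dots> = (\<integral>\<^sup>+e. (\<Sum>j\<in>UNIV. ennreal (\<Sum>i\<in>UNIV. w $ i * N e $ i $ j) * ennreal \<bar>x $ j\<bar>) \<partial>P)"
  proof (intro nn_integral_cong)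
    fix e
    have "0 \<le> (\<Sum>i\<in>UNIV. w $ i * N e $ i $ j)" for j
      by (intro sum_nonneg mult_nonneg_nonneg N_nonneg less_imp_le[OF w_pos])
    then show "ennreal (\<Sum>j\<in>UNIV. (\<Sum>i\<in>UNIV. w $ i * N e $ i $ j) * \<bar>x $ j\<bar>)
      = (\<Sum>j\<in>UNIV. ennreal (\<Sum>i\<in>UNIV. w $ i * N e $ i $ j) * ennreal \<bar>x $ j\<bar>)"
      by (subst sum_ennreal[symmetric]) (auto simp: ennreal_mult)
  qed
  also have "\<dots> = (\<Sum>j\<in>UNIV. (\<integral>\<^sup>+e. ennreal (\<Sum>i\<in>UNIV. w $ i * N e $ i $ j) \<partial>P) * ennreal \<bar>x $ j\<bar>)"
    by (subst nn_integral_sum) (auto simp: nn_integral_multc)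
  also have "\<dots> \<le> (\<Sum>j\<in>UNIV. ennreal (\<rho> * w $ j) * ennreal \<bar>x $ j\<bar>)"
    by (intro sum_mono mult_right_mono contraction) auto
  also have "\<dots> = ennreal (\<rho> * wnorm w x)"
    using \<rho> w_pos by (simp add: wnorm_def sum_distrib_left less_imp_le mult.assoc flip: ennreal_mult)
  finally show ?thesis .
qed


lemma w_nonneg: "0 \<le> w $ i" by (rule less_imp_le[OF w_pos])

lemma step_diff: "step x e - step y e = N e *v (x - y)"
  by (simp add: step_def matrix_vector_mult_diff_distrib)

definition averaged :: "(real^'n \<Rightarrow> real) \<Rightarrow> real^'n \<Rightarrow> real" where
  "averaged f x = (\<integral>e. f (step x e) \<partial>P)"

definition lipschitz01 :: "real \<Rightarrow> (real^'n \<Rightarrow> real) \<Rightarrow> bool" where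
  "lipschitz01 L f \<longleftrightarrow> 0 \<le> L \<and> (\<forall>x. 0 \<le> f x \<and> f x \<le> 1) \<and> (\<forall>x y. \<bar>f x - f y\<bar> \<le> L * wnorm w (x - y))"

lemma lipschitz01_measurable:
  assumes "lipschitz01 L f"
  shows "f \<in> borel_measurable borel"
proof -
  let ?K = "L * (\<Sum>i\<in>UNIV. w $ i)"
  have "?K-lipschitz_on UNIV f"
  proof (rule lipschitz_onI)
    fix x y
    have "\<bar>f x - f y\<bar> \<le> L * wnorm w (x - y)" using assms by (simp add: lipschitz01_def)
    also have "\<dots> \<le> L * ((\<Sum>i\<in>UNIV. w $ i) * norm (x - y))"
      using assms by (intro mult_left_mono wnorm_le_norm w_pos) (simp add: lipschitz01_def)
    finally show "dist (f x) (f y) \<le> ?K * dist x y" by (simp add: dist_norm mult.assoc)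
  qed (use assms in \<open>auto simp: lipschitz01_def intro!: mult_nonneg_nonneg sum_nonneg w_nonneg\<close>)
  then show ?thesis
    by (intro borel_measurable_continuous_onI lipschitz_on_continuous_on)
qed

text \<open>Averaging over one step multiplies the Lipschitz constant by \<open>\<rho>\<close>: two starting points are moved with
the same noise, and their distance contracts in mean.\<close>

lemma lipschitz01_averaged:
  assumes f: "lipschitz01 L f"
  shows "lipschitz01 (\<rho> * L) (averaged f)"
proof -
  note [measurable] = lipschitz01_measurable[OF f]
  have L: "0 \<le> L" and f01: "\<And>x. 0 \<le> f x" "\<And>x. f x \<le> 1"
    and lip: "\<And>x y. \<bar>f x - f y\<bar> \<le> L * wnorm w (x - y)"
    using f by (auto simp: lipschitz01_def)
  have int: "integrable P (\<lambda>e. f (step x e))" for x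
    by (rule integrable_const_bound[where B=1]) (use f01 in auto)
  have "\<bar>averaged f x - averaged f y\<bar> \<le> \<rho> * L * wnorm w (x - y)" for x y
  proof -
    have "ennreal \<bar>averaged f x - averaged f y\<bar> = ennreal (norm (\<integral>e. f (step x e) - f (step y e) \<partial>P))"
      by (simp add: averaged_def int)
    also have "\<dots> \<le> (\<integral>\<^sup>+e. ennreal (norm (f (step x e) - f (step y e))) \<partial>P)"
      by (intro integral_norm_bound_ennreal Bochner_Integration.integrable_diff int)
    also have "\<dots> \<le> (\<integral>\<^sup>+e. ennreal L * ennreal (wnorm w (N e *v (x - y))) \<partial>P)"
    proof (rule nn_integral_mono)
      fix e
      show "ennreal (norm (f (step x e) - f (step y e))) \<le> ennreal L * ennreal (wnorm w (N e *v (x - y)))"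
        using lip[of "step x e" "step y e"] L by (simp add: step_diff ennreal_leI flip: ennreal_mult')
    qed
    also have "\<dots> = ennreal L * (\<integral>\<^sup>+e. ennreal (wnorm w (N e *v (x - y))) \<partial>P)"
      by (rule nn_integral_cmult) (simp flip: step_diff)
    also have "\<dots> \<le> ennreal L * ennreal (\<rho> * wnorm w (x - y))"
      by (intro mult_left_mono nn_integral_wnorm_le) auto
    also have "\<dots> = ennreal (\<rho> * L * wnorm w (x - y))"
      using L by (simp add: ac_simps flip: ennreal_mult')
    finally show ?thesis
      using L \<rho> wnorm_nonneg[OF w_pos] by (subst (asm) ennreal_le_iff) auto
  qed
  moreover have "0 \<le> averaged f x" "averaged f x \<le> 1" for x
    unfolding averaged_def using integral_mono[OF int[of x], of "\<lambda>_. 1"] f01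
    by (auto simp: prob_space)
  ultimately show ?thesis using L \<rho> by (auto simp: lipschitz01_def)
qed

lemma integral_averaged_invariant:
  assumes "invariant \<mu>" and f: "lipschitz01 L f"
  shows "(\<integral>x. averaged f x \<partial>\<mu>) = (\<integral>x. f x \<partial>\<mu>)"
proof -
  note [measurable] = lipschitz01_measurable[OF f]
  have sets: "sets \<mu> = sets state_measure" and eq: "distr (\<mu> \<Otimes>\<^sub>M P) state_measure (\<lambda>(x, e). step x e) = \<mu>"
    using assms by (auto simp: invariant_def)
  interpret \<mu>: prob_space \<mu> using assms by (simp add: invariant_def)
  interpret pair_prob_space \<mu> P ..
  have [measurable]: "(\<lambda>x. x) \<in> borel_measurable \<mu>"
    using measurable_state_borel[of "\<lambda>x. x" state_measure] unfolding measurable_cong_sets[OF sets refl] by simp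
  have space: "space \<mu> = posvecs" using sets_eq_imp_space_eq[OF sets] by simp
  have step: "(\<lambda>(x, e). step x e) \<in> \<mu> \<Otimes>\<^sub>M P \<rightarrow>\<^sub>M state_measure"
    by (rule measurable_state_measureI) (auto simp: space_pair_measure space step_posvecs)
  have "(\<integral>x. f x \<partial>\<mu>) = (\<integral>x. f x \<partial>distr (\<mu> \<Otimes>\<^sub>M P) state_measure (\<lambda>(x, e). step x e))"
    by (simp add: eq)
  also have "\<dots> = (\<integral>z. f (step (fst z) (snd z)) \<partial>(\<mu> \<Otimes>\<^sub>M P))"
    by (subst integral_distr[OF step]) (auto intro: borel_measurable_state_measure simp: case_prod_beta)
  also have "\<dots> = (\<integral>x. \<integral>e. f (step x e) \<partial>P \<partial>\<mu>)"
    by (subst integral_fst'[symmetric])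
       (use f in \<open>auto intro!: P.integrable_const_bound[where B=1] simp: lipschitz01_def\<close>)
  finally show ?thesis by (simp add: averaged_def)
qed

text \<open>The \<open>n\<close>-fold average \<open>u n\<close> of a Lipschitz function has Lipschitz constant of order \<open>\<rho>\<^sup>n\<close>, so it becomes
constant in the limit, while its integral against an invariant law is that of the original function.
Hence this integral is the limit of \<open>u n 0\<close>, whichever invariant law is taken.\<close>

lemma invariant_unique:
  assumes "invariant \<mu>" "invariant \<nu>"
  shows "\<mu> = \<nu>"
proof (rule prob_eqI_lipschitz)
  show "prob_space \<mu>" "prob_space \<nu>" "sets \<mu> = sets state_measure" "sets \<nu> = sets state_measure"
    using assms by (auto simp: invariant_def)
  fix f :: "real^'n \<Rightarrow> real" and L
  assume f: "\<And>x. 0 \<le> f x" "\<And>x. f x \<le> 1" "\<And>x y. \<bar>f x - f y\<bar> \<le> L * norm (x - y)" "0 \<le> L"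
  obtain c where c: "0 < c" "\<And>x. norm x \<le> c * wnorm w x"
    using norm_le_wnorm[OF w_pos] by blast
  have f': "lipschitz01 (L * c) f"
    unfolding lipschitz01_def
  proof (intro conjI allI)
    show "\<bar>f x - f y\<bar> \<le> L * c * wnorm w (x - y)" for x y
      using f(3)[of x y] mult_left_mono[OF c(2)[of "x - y"] f(4)] by (simp add: mult.assoc)
  qed (use f c in auto)
  define u where "u n = (averaged ^^ n) f" for n
  have u: "lipschitz01 (\<rho> ^ n * (L * c)) (u n)" for n
    by (induction n) (auto simp: u_def f' mult.assoc dest: lipschitz01_averaged)
  have lim: "(\<lambda>n. u n 0) \<longlonglongrightarrow> (\<integral>x. f x \<partial>\<kappa>)" if \<kappa>: "invariant \<kappa>" for \<kappa>
  proof -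
    interpret \<kappa>: prob_space \<kappa> using \<kappa> by (simp add: invariant_def)
    have ms: "g \<in> borel_measurable \<kappa>" if "g \<in> borel_measurable borel" for g :: "real^'n \<Rightarrow> real"
      using \<kappa> measurable_cong_sets[OF _ refl, of \<kappa> state_measure] borel_measurable_state_measure[OF that]
      by (auto simp: invariant_def)
    note um = ms[OF lipschitz01_measurable[OF u]]
    have "(\<integral>x. u n x \<partial>\<kappa>) = (\<integral>x. f x \<partial>\<kappa>)" for n
      by (induction n) (use integral_averaged_invariant[OF \<kappa> u] in \<open>auto simp: u_def\<close>)
    moreover have "(\<integral>x. u n x - u n 0 \<partial>\<kappa>) = (\<integral>x. u n x \<partial>\<kappa>) - u n 0" for n
      using u[of n] \<kappa>.prob_space
      by (subst Bochner_Integration.integral_diff)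
         (auto intro!: \<kappa>.integrable_const_bound[where B=1] um simp: lipschitz01_def)
    moreover have "(\<lambda>n. \<integral>x. u n x - u n 0 \<partial>\<kappa>) \<longlonglongrightarrow> (\<integral>x. 0 \<partial>\<kappa>)"
    proof (rule integral_dominated_convergence[where w="\<lambda>_. 1"])
      show "AE x in \<kappa>. (\<lambda>n. u n x - u n 0) \<longlonglongrightarrow> 0"
      proof (rule AE_I2, rule Lim_null_comparison)
        fix x
        show "\<forall>\<^sub>F n in sequentially. norm (u n x - u n 0) \<le> \<rho> ^ n * (L * c * wnorm w x)"
        proof (rule always_eventually, rule allI)
          fix n
          have "\<bar>u n x - u n 0\<bar> \<le> \<rho> ^ n * (L * c) * wnorm w (x - 0)"
            using u[of n] unfolding lipschitz01_def by blast
          then show "norm (u n x - u n 0) \<le> \<rho> ^ n * (L * c * wnorm w x)" by (simp add: mult.assoc)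
        qed
        show "(\<lambda>n. \<rho> ^ n * (L * c * wnorm w x)) \<longlonglongrightarrow> 0"
          using \<rho> by (intro tendsto_mult_left_zero LIMSEQ_power_zero) auto
      qed
      show "AE x in \<kappa>. norm (u n x - u n 0) \<le> 1" for n
      proof (rule AE_I2)
        fix x
        have "0 \<le> u n x" "u n x \<le> 1" "0 \<le> u n 0" "u n 0 \<le> 1"
          using u[of n] by (auto simp: lipschitz01_def)
        then show "norm (u n x - u n 0) \<le> 1" by simp
      qed
    qed (auto intro!: borel_measurable_diff um)
    ultimately have "(\<lambda>n. (\<integral>x. f x \<partial>\<kappa>) - u n 0) \<longlonglongrightarrow> 0" by simp
    from tendsto_diff[OF tendsto_const[of "\<integral>x. f x \<partial>\<kappa>"] this] show ?thesis by simp
  qed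
  from lim[OF assms(1)] lim[OF assms(2)] show "(\<integral>x. f x \<partial>\<mu>) = (\<integral>x. f x \<partial>\<nu>)"
    by (rule LIMSEQ_unique)
qed

lemma measurable_N_mult [measurable]: "(\<lambda>e. N e *v x) \<in> borel_measurable P"
  by (rule borel_measurable_vecI) (simp add: matrix_vector_mult_def)

text \<open>The recursion is run backwards: the head of the noise stream is applied last. The resulting
sequence is monotone in \<open>n\<close> for a fixed stream, whereas the forward iterates converge
only in law.\<close>

primrec iterates :: "nat \<Rightarrow> 'e stream \<Rightarrow> real^'n" where
  "iterates 0 = (\<lambda>s. 0)"
| "iterates (Suc n) = (\<lambda>s. step (iterates n (stl s)) (shd s))"

text \<open>The default value \<open>\<omega>\<close> keeps \<open>limit_state\<close> inside \<^const>\<open>posvecs\<close>; it can occur only on streams without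
convergence, where \<^const>\<open>lim\<close> is arbitrary. Testing the sign of the limits, instead of their existence,
makes measurability immediate.\<close>

definition limit_state :: "'e stream \<Rightarrow> real^'n" where
  "limit_state s = (if \<forall>i. 0 < lim (\<lambda>n. iterates n s $ i) then \<chi> i. lim (\<lambda>n. iterates n s $ i) else \<omega>)"

lemma iterates_nonneg: "0 \<le> iterates n s $ i"
proof (induction n arbitrary: s i)
  case (Suc n)
  have "0 \<le> \<omega> $ i" by (rule less_imp_le[OF \<omega>_pos])
  also have "\<dots> \<le> step (iterates n (stl s)) (shd s) $ i" by (rule step_ge) (rule Suc)
  finally show ?case by simp
qed simp

lemma iterates_mono: "iterates n s $ i \<le> iterates (Suc n) s $ i"
proof (induction n arbitrary: s i)
  case 0
  then show ?case using iterates_nonneg[of "Suc 0"] by simp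
next
  case (Suc n)
  then show ?case by (simp only: iterates.simps) (intro step_mono)
qed

lemma iterates_ge: "\<omega> $ i \<le> iterates (Suc n) s $ i"
  by (simp add: step_ge iterates_nonneg)

lemma measurable_iterates [measurable]: "iterates n \<in> borel_measurable (stream_space P)"
  by (induction n) simp_all

lemma measurable_limit_state: "limit_state \<in> stream_space P \<rightarrow>\<^sub>M state_measure"
proof (rule measurable_state_measureI)
  show "limit_state \<in> borel_measurable (stream_space P)"
  proof (rule borel_measurable_vecI)
    fix i
    have "limit_state s $ i = (if \<forall>i. 0 < lim (\<lambda>n. iterates n s $ i) then lim (\<lambda>n. iterates n s $ i) else \<omega> $ i)" for s
      by (simp add: limit_state_def)
    then show "(\<lambda>s. limit_state s $ i) \<in> borel_measurable (stream_space P)"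
      by simp
  qed
qed (auto simp: limit_state_def posvecs_def \<omega>_pos)

text \<open>The weighted means satisfy \<open>c (n + 1) \<le> wnorm w \<omega> + \<rho> * c n\<close>, and the bound is the fixed point of this
inequality.\<close>

lemma nn_integral_wnorm_iterates:
  "(\<integral>\<^sup>+s. ennreal (wnorm w (iterates n s)) \<partial>stream_space P) \<le> ennreal (wnorm w \<omega> / (1 - \<rho>))"
proof (induction n)
  case 0
  then show ?case by (simp add: wnorm_def)
next
  case (Suc n)
  interpret S: prob_space "stream_space P" by (rule prob_space_stream_space)
  interpret pair_sigma_finite P "stream_space P" ..
  note nn = wnorm_nonneg[OF w_pos]
  have "(\<integral>\<^sup>+s. ennreal (wnorm w (iterates (Suc n) s)) \<partial>stream_space P)
    = (\<integral>\<^sup>+e. \<integral>\<^sup>+s. ennreal (wnorm w (step (iterates n s) e)) \<partial>stream_space P \<partial>P)"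
    by (subst nn_integral_stream_space) simp_all
  also have "\<dots> = (\<integral>\<^sup>+s. \<integral>\<^sup>+e. ennreal (wnorm w (step (iterates n s) e)) \<partial>P \<partial>stream_space P)"
    by (rule Fubini'[symmetric]) simp
  also have "\<dots> \<le> (\<integral>\<^sup>+s. ennreal (wnorm w \<omega>) + ennreal \<rho> * ennreal (wnorm w (iterates n s)) \<partial>stream_space P)"
  proof (rule nn_integral_mono)
    fix s
    have "(\<integral>\<^sup>+e. ennreal (wnorm w (step (iterates n s) e)) \<partial>P)
      \<le> (\<integral>\<^sup>+e. ennreal (wnorm w \<omega>) + ennreal (wnorm w (N e *v iterates n s)) \<partial>P)"
      unfolding step_def
      by (intro nn_integral_mono) (simp add: nn wnorm_add_le w_pos ennreal_leI flip: ennreal_plus)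
    also have "\<dots> = ennreal (wnorm w \<omega>) + (\<integral>\<^sup>+e. ennreal (wnorm w (N e *v iterates n s)) \<partial>P)"
      by (subst nn_integral_add) (simp_all add: emeasure_space_1)
    also have "\<dots> \<le> ennreal (wnorm w \<omega>) + ennreal \<rho> * ennreal (wnorm w (iterates n s))"
      using nn_integral_wnorm_le[of "iterates n s"] \<rho> nn by (intro add_left_mono) (simp add: ennreal_mult)
    finally show "(\<integral>\<^sup>+e. ennreal (wnorm w (step (iterates n s) e)) \<partial>P)
      \<le> ennreal (wnorm w \<omega>) + ennreal \<rho> * ennreal (wnorm w (iterates n s))" .
  qed
  also have "\<dots> = ennreal (wnorm w \<omega>) + ennreal \<rho> * (\<integral>\<^sup>+s. ennreal (wnorm w (iterates n s)) \<partial>stream_space P)"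
    by (simp add: nn_integral_add nn_integral_cmult S.emeasure_space_1)
  also have "\<dots> \<le> ennreal (wnorm w \<omega>) + ennreal \<rho> * ennreal (wnorm w \<omega> / (1 - \<rho>))"
    by (intro add_left_mono mult_left_mono Suc) auto
  also have "\<dots> = ennreal (wnorm w \<omega> / (1 - \<rho>))"
    using \<rho> nn[of \<omega>] by (simp add: field_simps flip: ennreal_mult ennreal_plus)
  finally show ?case .
qed

lemma nn_integral_SUP_iterates:
  "(\<integral>\<^sup>+s. (SUP n. ennreal (wnorm w (iterates n s))) \<partial>stream_space P) < \<infinity>"
proof -
  have "incseq (\<lambda>n s. ennreal (wnorm w (iterates n s)))"
  proof (rule incseq_SucI, rule le_funI, rule ennreal_leI)
    fix n s
    show "wnorm w (iterates n s) \<le> wnorm w (iterates (Suc n) s)"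
      unfolding wnorm_def using iterates_mono[of n s] iterates_nonneg
      by (intro sum_mono mult_left_mono w_nonneg) (simp del: iterates.simps)
  qed
  then have "(\<integral>\<^sup>+s. (SUP n. ennreal (wnorm w (iterates n s))) \<partial>stream_space P)
    = (SUP n. \<integral>\<^sup>+s. ennreal (wnorm w (iterates n s)) \<partial>stream_space P)"
    by (intro nn_integral_monotone_convergence_SUP) auto
  also have "\<dots> \<le> ennreal (wnorm w \<omega> / (1 - \<rho>))"
    by (intro SUP_least nn_integral_wnorm_iterates)
  finally show ?thesis by (rule order.strict_trans1) simp
qed

definition converges :: "'e stream \<Rightarrow> bool" where
  "converges s \<longleftrightarrow> (\<forall>i. convergent (\<lambda>n. iterates n s $ i))"

lemma limit_state_lim:
  assumes "converges s"
  shows "(\<lambda>n. iterates n s $ i) \<longlonglongrightarrow> limit_state s $ i"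
proof -
  have lim: "(\<lambda>n. iterates n s $ i) \<longlonglongrightarrow> lim (\<lambda>n. iterates n s $ i)" for i
    using assms by (simp add: converges_def convergent_LIMSEQ_iff)
  have "0 < lim (\<lambda>n. iterates n s $ i)" for i
    by (rule less_le_trans[OF \<omega>_pos[of i]], rule LIMSEQ_le_const[OF LIMSEQ_Suc[OF lim[of i]]])
       (use iterates_ge[of i _ s] in blast)
  then show ?thesis using lim by (simp add: limit_state_def)
qed

text \<open>A finite mean makes the supremum of the weighted norms finite almost surely, and bounded
monotone coordinates converge.\<close>

lemma AE_converges: "AE s in stream_space P. converges s"
proof -
  have "AE s in stream_space P. (SUP n. ennreal (wnorm w (iterates n s))) \<noteq> \<infinity>"
    using nn_integral_SUP_iterates by (intro nn_integral_PInf_AE) auto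
  then show ?thesis
  proof eventually_elim
    case (elim s)
    then obtain B where "(SUP n. ennreal (wnorm w (iterates n s))) \<le> ennreal B" "0 \<le> B"
      by (cases "SUP n. ennreal (wnorm w (iterates n s))") auto
    then have B: "wnorm w (iterates n s) \<le> B" for n
    proof -
      have "ennreal (wnorm w (iterates n s)) \<le> (SUP n. ennreal (wnorm w (iterates n s)))"
        by (rule SUP_upper) simp
      also have "\<dots> \<le> ennreal B" by fact
      finally show ?thesis using \<open>0 \<le> B\<close> by simp
    qed
    show ?case unfolding converges_def
    proof
      fix i
      have "w $ i * (iterates n s $ i) \<le> B" for n
      proof -
        have "w $ i * \<bar>iterates n s $ i\<bar> \<le> wnorm w (iterates n s)"
          unfolding wnorm_def by (rule member_le_sum) (auto simp: w_nonneg)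
        then show ?thesis using B[of n] iterates_nonneg[of n s i] by simp
      qed
      then have "\<forall>n. iterates n s $ i \<le> B / w $ i"
        using w_pos[of i] by (simp add: field_simps)
      moreover have "incseq (\<lambda>n. iterates n s $ i)"
        by (rule incseq_SucI) (rule iterates_mono)
      ultimately obtain l where "(\<lambda>n. iterates n s $ i) \<longlonglongrightarrow> l"
        using incseq_convergent by blast
      then show "convergent (\<lambda>n. iterates n s $ i)" by (rule convergentI)
    qed
  qed
qed

text \<open>The pathwise fixed-point equation: prepending a noise value is one more step of the recursion.\<close>

lemma limit_state_Stream:
  assumes "converges s"
  shows "limit_state (e ## s) = step (limit_state s) e"
proof -
  have lim: "(\<lambda>n. iterates (Suc n) (e ## s) $ i) \<longlonglongrightarrow> step (limit_state s) e $ i" for i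
    unfolding iterates.simps step_def matrix_vector_mult_def stream.sel vector_add_component vec_lambda_beta
    by (intro tendsto_intros limit_state_lim assms)
  have "converges (e ## s)"
    unfolding converges_def by (rule allI, rule convergentI, rule LIMSEQ_imp_Suc, rule lim)
  from limit_state_lim[OF this] have "limit_state (e ## s) $ i = step (limit_state s) e $ i" for i
    by (rule LIMSEQ_unique[OF LIMSEQ_Suc lim])
  then show ?thesis by (simp add: vec_eq_iff)
qed

text \<open>Prepending independent noise to a noise stream does not change the law of the stream, while it
moves the limit by one step.\<close>

lemma invariant_limit_state: "invariant (distr (stream_space P) state_measure limit_state)"
  (is "invariant ?\<mu>")
proof -
  note integrate_noise_first = nn_integral_fst
    and measurable_noise_integral = borel_measurable_nn_integral_fst
  note [measurable] = measurable_limit_state measurable_state_borel[OF measurable_limit_state]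
  interpret S: prob_space "stream_space P" by (rule prob_space_stream_space)
  interpret pair_sigma_finite P "stream_space P" ..
  interpret \<mu>: prob_space ?\<mu> by (intro S.prob_space_distr measurable_limit_state)
  have state: "(\<lambda>z. step (f z) (g z)) \<in> M \<rightarrow>\<^sub>M state_measure"
    if "f \<in> M \<rightarrow>\<^sub>M state_measure" "g \<in> M \<rightarrow>\<^sub>M P" for f g and M :: "'x measure"
    using measurable_space[OF that(1)]
    by (intro measurable_state_measureI measurable_step measurable_state_borel[OF that(1)] that(2) step_posvecs) simp
  have "distr (?\<mu> \<Otimes>\<^sub>M P) state_measure (\<lambda>(x, e). step x e) = ?\<mu>"
  proof (rule measure_eqI)
    fix A assume "A \<in> sets (distr (?\<mu> \<Otimes>\<^sub>M P) state_measure (\<lambda>(x, e). step x e))"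
    then have A[measurable]: "A \<in> sets state_measure" by simp
    have m1: "(\<lambda>(x, e). step x e) \<in> ?\<mu> \<Otimes>\<^sub>M P \<rightarrow>\<^sub>M state_measure"
      using state[of fst "?\<mu> \<Otimes>\<^sub>M P" snd] by (simp add: case_prod_beta)
    have m2: "(\<lambda>z. indicator A (step (fst z) (snd z)) :: ennreal) \<in> borel_measurable (state_measure \<Otimes>\<^sub>M P)"
      using state[of fst "state_measure \<Otimes>\<^sub>M P" snd] by (intro borel_measurable_indicator' A) simp
    have m3: "(\<lambda>z. indicator A (step (limit_state (snd z)) (fst z)) :: ennreal) \<in> borel_measurable (P \<Otimes>\<^sub>M stream_space P)"
      using state[of "\<lambda>z. limit_state (snd z)" "P \<Otimes>\<^sub>M stream_space P" fst] by (intro borel_measurable_indicator' A) simp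
    have "emeasure (distr (?\<mu> \<Otimes>\<^sub>M P) state_measure (\<lambda>(x, e). step x e)) A
      = (\<integral>\<^sup>+z. indicator A (step (fst z) (snd z)) \<partial>(?\<mu> \<Otimes>\<^sub>M P))"
      by (subst nn_integral_indicator[symmetric], simp, subst nn_integral_distr[OF m1])
         (auto simp: case_prod_beta)
    also have "\<dots> = (\<integral>\<^sup>+x. \<integral>\<^sup>+e. indicator A (step x e) \<partial>P \<partial>?\<mu>)"
      using m2 by (subst integrate_noise_first[symmetric]) (simp_all cong: measurable_cong_sets sets_pair_measure_cong)
    also have "\<dots> = (\<integral>\<^sup>+s. \<integral>\<^sup>+e. indicator A (step (limit_state s) e) \<partial>P \<partial>stream_space P)"
      using measurable_noise_integral[OF m2] by (subst nn_integral_distr) simp_all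
    also have "\<dots> = (\<integral>\<^sup>+e. \<integral>\<^sup>+s. indicator A (step (limit_state s) e) \<partial>stream_space P \<partial>P)"
      using m3 by (intro Fubini') (simp add: case_prod_beta)
    also have "\<dots> = (\<integral>\<^sup>+e. \<integral>\<^sup>+s. indicator A (limit_state (e ## s)) \<partial>stream_space P \<partial>P)"
    proof (rule nn_integral_cong, rule nn_integral_cong_AE)
      fix e
      show "AE s in stream_space P. indicator A (step (limit_state s) e) = (indicator A (limit_state (e ## s)) :: ennreal)"
        using AE_converges by eventually_elim (simp add: limit_state_Stream)
    qed
    also have "\<dots> = (\<integral>\<^sup>+s. indicator A (limit_state s) \<partial>stream_space P)"
      by (subst nn_integral_stream_space) simp_all
    also have "\<dots> = emeasure ?\<mu> A"
      by (subst nn_integral_indicator[symmetric], simp, subst nn_integral_distr) auto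
    finally show "emeasure (distr (?\<mu> \<Otimes>\<^sub>M P) state_measure (\<lambda>(x, e). step x e)) A = emeasure ?\<mu> A" .
  qed simp
  then show ?thesis unfolding invariant_def using \<mu>.prob_space_axioms by simp
qed

lemma nn_integral_wnorm_limit_state:
  "(\<integral>\<^sup>+x. ennreal (wnorm w x) \<partial>distr (stream_space P) state_measure limit_state) < \<infinity>"
proof -
  note [measurable] = measurable_limit_state
  have "(\<integral>\<^sup>+x. ennreal (wnorm w x) \<partial>distr (stream_space P) state_measure limit_state)
    = (\<integral>\<^sup>+s. ennreal (wnorm w (limit_state s)) \<partial>stream_space P)"
    by (rule nn_integral_distr) (auto intro!: measurable_compose[OF borel_measurable_state_measure measurable_ennreal])
  also have "\<dots> \<le> (\<integral>\<^sup>+s. (SUP n. ennreal (wnorm w (iterates n s))) \<partial>stream_space P)"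
  proof (rule nn_integral_mono_AE)
    show "AE s in stream_space P. ennreal (wnorm w (limit_state s)) \<le> (SUP n. ennreal (wnorm w (iterates n s)))"
      using AE_converges
    proof eventually_elim
      case (elim s)
      have "(\<lambda>n. wnorm w (iterates n s)) \<longlonglongrightarrow> wnorm w (limit_state s)"
        unfolding wnorm_def by (intro tendsto_intros limit_state_lim elim)
      then have "(\<lambda>n. ennreal (wnorm w (iterates n s))) \<longlonglongrightarrow> ennreal (wnorm w (limit_state s))"
        by (rule tendsto_ennrealI)
      then show ?case by (rule LIMSEQ_le_const2) (intro exI allI impI SUP_upper UNIV_I)
    qed
  qed
  also have "\<dots> < \<infinity>" by (rule nn_integral_SUP_iterates)
  finally show ?thesis .
qed

lemma invariant_exists_unique: "\<exists>!\<mu>. invariant \<mu>"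
  using invariant_limit_state invariant_unique by blast

lemma invariant_mean_finite:
  assumes "invariant \<mu>"
  shows "(\<integral>\<^sup>+x. ennreal (wnorm w x) \<partial>\<mu>) < \<infinity>"
  using nn_integral_wnorm_limit_state invariant_unique[OF assms invariant_limit_state] by simp

end

section \<open>The kernel as an affine recursion\<close>

text \<open>The randomness behind one observation: a mixture component and an independent standard normal
variable, carried by a space that depends on neither the state nor the previous observation.\<close>

definition mixing_noise :: "real^'n::finite \<Rightarrow> ('n \<times> real) measure" where
  "mixing_noise \<gamma> = density (count_space UNIV) (\<lambda>l. ennreal (\<gamma> $ l)) \<Otimes>\<^sub>M std_normal_distribution"

definition emission :: "real^'n::finite \<Rightarrow> 'n \<times> real \<Rightarrow> real" where
  "emission x = (\<lambda>(l, \<epsilon>). sqrt (x $ l) * \<epsilon>)"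

definition noise_matrix :: "real^'n::finite^'n \<Rightarrow> real^'n \<Rightarrow> 'n \<times> real \<Rightarrow> real^'n^'n" where
  "noise_matrix A b = (\<lambda>(l, \<epsilon>). \<chi> i j. A $ i $ j + (if j = l then b $ i * \<epsilon>\<^sup>2 else 0))"

lemma sets_mixing_noise [measurable_cong]:
  "sets (mixing_noise \<gamma>) = sets (count_space UNIV \<Otimes>\<^sub>M borel)"
  unfolding mixing_noise_def by (intro sets_pair_measure_cong) auto

lemma space_mixing_noise [simp]: "space (mixing_noise \<gamma>) = UNIV"
  by (simp add: mixing_noise_def space_pair_measure)

lemma nn_integral_mixing_noise:
  assumes [measurable]: "f \<in> borel_measurable (count_space UNIV \<Otimes>\<^sub>M borel)"
  shows "(\<integral>\<^sup>+e. f e \<partial>mixing_noise \<gamma>) = (\<Sum>l\<in>UNIV. ennreal (\<gamma> $ l) * (\<integral>\<^sup>+\<epsilon>. f (l, \<epsilon>) \<partial>std_normal_distribution))"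
proof -
  interpret prob_space std_normal_distribution by (rule prob_space_normal_density) simp
  have "(\<integral>\<^sup>+e. f e \<partial>mixing_noise \<gamma>)
    = (\<integral>\<^sup>+l. \<integral>\<^sup>+\<epsilon>. f (l, \<epsilon>) \<partial>std_normal_distribution \<partial>density (count_space UNIV) (\<lambda>l. ennreal (\<gamma> $ l)))"
    unfolding mixing_noise_def by (rule nn_integral_fst[symmetric]) measurable
  also have "\<dots> = (\<integral>\<^sup>+l. ennreal (\<gamma> $ l) * (\<integral>\<^sup>+\<epsilon>. f (l, \<epsilon>) \<partial>std_normal_distribution) \<partial>count_space UNIV)"
    by (rule nn_integral_density) auto
  also have "\<dots> = (\<Sum>l\<in>UNIV. ennreal (\<gamma> $ l) * (\<integral>\<^sup>+\<epsilon>. f (l, \<epsilon>) \<partial>std_normal_distribution))"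
    by (rule nn_integral_count_space_finite) simp
  finally show ?thesis .
qed

lemma simplex_weightsD:
  assumes "\<gamma> \<in> simplex_weights"
  shows "0 \<le> \<gamma> $ l" "(\<Sum>l\<in>UNIV. \<gamma> $ l) = 1"
  using assms by (auto simp: simplex_weights_def nonnegvecs_def)

lemma prob_space_mixing_noise:
  assumes \<gamma>: "\<gamma> \<in> simplex_weights"
  shows "prob_space (mixing_noise \<gamma>)"
proof
  interpret prob_space std_normal_distribution by (rule prob_space_normal_density) simp
  have "emeasure (mixing_noise \<gamma>) (space (mixing_noise \<gamma>)) = (\<integral>\<^sup>+e. 1 \<partial>mixing_noise \<gamma>)" by simp
  also have "\<dots> = (\<Sum>l\<in>UNIV. ennreal (\<gamma> $ l))"
    using emeasure_space_1 by (subst nn_integral_mixing_noise) auto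
  also have "\<dots> = 1"
    using simplex_weightsD[OF \<gamma>] by (simp add: sum_ennreal)
  finally show "emeasure (mixing_noise \<gamma>) (space (mixing_noise \<gamma>)) = 1" .
qed

lemma nn_integral_std_normal_quadratic:
  assumes "0 \<le> a" "0 \<le> c"
  shows "(\<integral>\<^sup>+\<epsilon>. ennreal (a + c * \<epsilon>\<^sup>2) \<partial>std_normal_distribution) = ennreal (a + c)"
proof -
  have 0: "has_bochner_integral lborel std_normal_density 1"
    using std_normal_moment_even[of 0] by simp
  have 1: "has_bochner_integral lborel (\<lambda>x. std_normal_density x * x\<^sup>2) 1"
    using std_normal_moment_even[of 1] by simp
  have I: "has_bochner_integral lborel (\<lambda>x. a * std_normal_density x + c * (std_normal_density x * x\<^sup>2)) (a * 1 + c * 1)"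
    by (intro has_bochner_integral_add has_bochner_integral_mult_right 0 1)
  have "(\<integral>\<^sup>+\<epsilon>. ennreal (a + c * \<epsilon>\<^sup>2) \<partial>std_normal_distribution)
    = (\<integral>\<^sup>+x. ennreal (a * std_normal_density x + c * (std_normal_density x * x\<^sup>2)) \<partial>lborel)"
    using assms by (subst nn_integral_density) (auto intro!: nn_integral_cong simp: algebra_simps simp flip: ennreal_mult)
  also have "\<dots> = ennreal (a + c)"
    using I assms by (subst nn_integral_eq_integral) (auto simp: has_bochner_integral_iff)
  finally show ?thesis .
qed

lemma measurable_emission [measurable (raw)]:
  assumes [measurable]: "f \<in> borel_measurable M" "g \<in> M \<rightarrow>\<^sub>M count_space UNIV \<Otimes>\<^sub>M borel"
  shows "(\<lambda>z. emission (f z) (g z)) \<in> borel_measurable M"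
proof -
  have "(\<lambda>z. f z $ fst (g z)) \<in> borel_measurable M"
    by (rule measurable_compose_countable[where g="\<lambda>z. fst (g z)"]) measurable
  then show ?thesis unfolding emission_def case_prod_beta by measurable
qed

text \<open>The square of the observation is \<open>x $ l * \<epsilon>\<^sup>2\<close>, linear in the state; this is where the update becomes
an affine map with random coefficients.\<close>

lemma nm_psi_emission:
  assumes "x \<in> posvecs"
  shows "nm_psi (\<gamma>, \<omega>, A, b) (emission x e) x = \<omega> + noise_matrix A b e *v x"
proof -
  have "0 \<le> x $ l" for l using assms by (simp add: posvecs_def less_imp_le)
  then show ?thesis
    by (simp add: nm_psi_def emission_def noise_matrix_def vec_eq_iff matrix_vector_mult_def case_prod_beta
      power_mult_distrib distrib_right sum.distrib if_distrib[where f="\<lambda>x. x * _"] cong: if_cong)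
qed

lemma nm_psi_posvecs:
  assumes "(\<gamma>, \<omega>, A, b) \<in> param_space" "x \<in> posvecs"
  shows "\<omega> $ i \<le> nm_psi (\<gamma>, \<omega>, A, b) y x $ i" "nm_psi (\<gamma>, \<omega>, A, b) y x \<in> posvecs"
proof -
  show le: "\<omega> $ i \<le> nm_psi (\<gamma>, \<omega>, A, b) y x $ i" for i
    using assms by (auto simp: nm_psi_def matrix_vector_mult_def param_space_def nonnegvecs_def posvecs_def less_imp_le
      intro!: sum_nonneg add_nonneg_nonneg mult_nonneg_nonneg)
  have "0 < \<omega> $ i" for i using assms(1) by (simp add: param_space_def posvecs_def)
  with le show "nm_psi (\<gamma>, \<omega>, A, b) y x \<in> posvecs"
    unfolding posvecs_def using less_le_trans by blast
qed

lemma nm_g_normal_density: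
  assumes "x \<in> posvecs"
  shows "nm_g (\<gamma>, \<omega>, A, b) x y = (\<Sum>l\<in>UNIV. \<gamma> $ l * normal_density 0 (sqrt (x $ l)) y)"
  using assms by (auto simp: nm_g_def normal_density_def posvecs_def less_imp_le intro!: sum.cong)

text \<open>Each component is a centred normal density with variance \<open>x $ l\<close>, which is the image of the standard
normal law under scaling by \<open>sqrt (x $ l)\<close>.\<close>

lemma nm_G_eq_distr:
  assumes \<gamma>: "\<gamma> \<in> simplex_weights" and x: "x \<in> posvecs"
  shows "nm_G (\<gamma>, \<omega>, A, b) x = distr (mixing_noise \<gamma>) borel (emission x)"
proof (rule measure_eqI)
  fix B assume "B \<in> sets (nm_G (\<gamma>, \<omega>, A, b) x)"
  then have [measurable]: "B \<in> sets borel" by (simp add: nm_G_def)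
  have pos: "0 < x $ l" for l using x by (simp add: posvecs_def)
  have "emeasure (nm_G (\<gamma>, \<omega>, A, b) x) B
    = (\<integral>\<^sup>+y. (\<Sum>l\<in>UNIV. ennreal (\<gamma> $ l) * (ennreal (normal_density 0 (sqrt (x $ l)) y) * indicator B y)) \<partial>lborel)"
    unfolding nm_G_def nm_g_normal_density[OF x]
    using simplex_weightsD(1)[OF \<gamma>]
    by (subst emeasure_density) (auto intro!: nn_integral_cong
      simp: sum_distrib_right normal_density_nonneg ennreal_mult mult.assoc simp flip: sum_ennreal)
  also have "\<dots> = (\<Sum>l\<in>UNIV. ennreal (\<gamma> $ l) * (\<integral>\<^sup>+y. ennreal (normal_density 0 (sqrt (x $ l)) y) * indicator B y \<partial>lborel))"
    by (subst nn_integral_sum) (auto simp: nn_integral_cmult)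
  also have "\<dots> = (\<Sum>l\<in>UNIV. ennreal (\<gamma> $ l) * (\<integral>\<^sup>+\<epsilon>. indicator B (emission x (l, \<epsilon>)) \<partial>std_normal_distribution))"
  proof (rule sum.cong[OF refl])
    fix l
    have dens: "sqrt (x $ l) * normal_density 0 (sqrt (x $ l)) (sqrt (x $ l) * \<epsilon>) = std_normal_density \<epsilon>" for \<epsilon>
      using pos[of l] by (simp add: normal_density_def real_sqrt_mult power_mult_distrib field_simps)
    have "(\<integral>\<^sup>+y. ennreal (normal_density 0 (sqrt (x $ l)) y) * indicator B y \<partial>lborel)
      = (\<integral>\<^sup>+\<epsilon>. ennreal (sqrt (x $ l)) * (ennreal (normal_density 0 (sqrt (x $ l)) (sqrt (x $ l) * \<epsilon>)) * indicator B (sqrt (x $ l) * \<epsilon>)) \<partial>lborel)"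
      using pos[of l] by (subst nn_integral_real_affine[where t=0 and c="sqrt (x $ l)"]) (auto simp: nn_integral_cmult)
    also have "\<dots> = (\<integral>\<^sup>+\<epsilon>. ennreal (std_normal_density \<epsilon>) * indicator B (sqrt (x $ l) * \<epsilon>) \<partial>lborel)"
      using pos[of l] unfolding dens[symmetric]
      by (intro nn_integral_cong) (simp add: ennreal_mult mult.assoc normal_density_nonneg less_imp_le)
    also have "\<dots> = (\<integral>\<^sup>+\<epsilon>. indicator B (emission x (l, \<epsilon>)) \<partial>std_normal_distribution)"
      by (subst nn_integral_density) (auto simp: emission_def)
    finally show "ennreal (\<gamma> $ l) * (\<integral>\<^sup>+y. ennreal (normal_density 0 (sqrt (x $ l)) y) * indicator B y \<partial>lborel)
      = ennreal (\<gamma> $ l) * (\<integral>\<^sup>+\<epsilon>. indicator B (emission x (l, \<epsilon>)) \<partial>std_normal_distribution)" by simp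
  qed
  also have "\<dots> = (\<integral>\<^sup>+e. indicator B (emission x e) \<partial>mixing_noise \<gamma>)"
    by (rule nn_integral_mixing_noise[symmetric]) measurable
  also have "\<dots> = emeasure (distr (mixing_noise \<gamma>) borel (emission x)) B"
    by (subst nn_integral_indicator[symmetric], simp, subst nn_integral_distr) auto
  finally show "emeasure (nm_G (\<gamma>, \<omega>, A, b) x) B = emeasure (distr (mixing_noise \<gamma>) borel (emission x)) B" .
qed (simp add: nm_G_def)

text \<open>The second moment of \<open>\<epsilon>\<close> is one, so the mean of \<^term>\<open>noise_matrix A b\<close> is \<^term>\<open>A + outer_prod b \<gamma>\<close>.\<close>

lemma recursion_mixing_noise:
  assumes \<theta>: "(\<gamma>, \<omega>, A, b) \<in> param_space" and w: "\<And>i. 0 < w $ i" and \<rho>: "0 < \<rho>" "\<rho> < 1"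
    and sub: "\<And>j. (\<Sum>i\<in>UNIV. w $ i * (A + outer_prod b \<gamma>) $ i $ j) \<le> \<rho> * w $ j"
  shows "positive_affine_recursion (mixing_noise \<gamma>) (noise_matrix A b) \<omega> w \<rho>"
proof -
  have \<gamma>: "\<gamma> \<in> simplex_weights" and A: "0 \<le> A $ i $ j" and b: "0 \<le> b $ i" and \<omega>: "0 < \<omega> $ i" for i j
    using \<theta> by (auto simp: param_space_def nonnegvecs_def posvecs_def)
  have meas: "(\<lambda>e. noise_matrix A b e $ i $ j) \<in> borel_measurable (count_space UNIV \<Otimes>\<^sub>M borel)" for i j
    unfolding noise_matrix_def case_prod_beta vec_lambda_beta by measurable
  interpret prob_space "mixing_noise \<gamma>" by (rule prob_space_mixing_noise[OF \<gamma>])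
  show ?thesis
  proof unfold_locales
    fix j
    define a where "a = (\<Sum>i\<in>UNIV. w $ i * A $ i $ j)"
    define c where "c = (\<Sum>i\<in>UNIV. w $ i * b $ i)"
    have ac: "0 \<le> a" "0 \<le> c"
      unfolding a_def c_def by (intro sum_nonneg mult_nonneg_nonneg less_imp_le[OF w] A b)+
    have "(\<integral>\<^sup>+e. ennreal (\<Sum>i\<in>UNIV. w $ i * noise_matrix A b e $ i $ j) \<partial>mixing_noise \<gamma>)
      = (\<Sum>l\<in>UNIV. ennreal (\<gamma> $ l) * (\<integral>\<^sup>+\<epsilon>. ennreal (a + (if j = l then c else 0) * \<epsilon>\<^sup>2) \<partial>std_normal_distribution))"
      using meas by (subst nn_integral_mixing_noise)
        (auto simp: noise_matrix_def a_def c_def distrib_left sum.distrib sum_distrib_right mult.assoc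
          intro!: sum.cong nn_integral_cong arg_cong2[where f="(*)"])
    also have "\<dots> = (\<Sum>l\<in>UNIV. ennreal (\<gamma> $ l * (a + (if j = l then c else 0))))"
      using ac simplex_weightsD(1)[OF \<gamma>]
      by (intro sum.cong refl, subst nn_integral_std_normal_quadratic) (auto simp: ennreal_mult)
    also have "\<dots> = ennreal (\<Sum>l\<in>UNIV. \<gamma> $ l * (a + (if j = l then c else 0)))"
      using ac simplex_weightsD(1)[OF \<gamma>] by (intro sum_ennreal) auto
    also have "(\<Sum>l\<in>UNIV. \<gamma> $ l * (a + (if j = l then c else 0))) = a + c * \<gamma> $ j"
      using simplex_weightsD(2)[OF \<gamma>]
      by (simp add: distrib_left sum.distrib sum_distrib_right[symmetric] if_distrib[where f="\<lambda>x. _ * x"] cong: if_cong)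
    also have "a + c * \<gamma> $ j = (\<Sum>i\<in>UNIV. w $ i * (A + outer_prod b \<gamma>) $ i $ j)"
      by (simp add: a_def c_def outer_prod_def distrib_left sum.distrib sum_distrib_right mult.assoc)
    finally show "(\<integral>\<^sup>+e. ennreal (\<Sum>i\<in>UNIV. w $ i * noise_matrix A b e $ i $ j) \<partial>mixing_noise \<gamma>) \<le> ennreal (\<rho> * w $ j)"
      using sub[of j] by (simp add: ennreal_leI)
  next
    show "(\<lambda>e. noise_matrix A b e $ i $ j) \<in> borel_measurable (mixing_noise \<gamma>)" for i j
      using meas measurable_cong_sets[OF sets_mixing_noise refl] by blast
    show "0 \<le> noise_matrix A b e $ i $ j" for e i j
      using A b by (auto simp: noise_matrix_def split: prod.split)
  qed (use \<omega> w \<rho> in auto)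
qed

text \<open>A kernel given by a map of the current point and independent noise can be composed on the product
with the noise, which replaces the measurability questions about \<open>bind\<close> by those of a map.\<close>

lemma bind_distr_kernel:
  assumes "prob_space P" and M: "space M \<noteq> {}"
    and h[measurable]: "(\<lambda>(x, e). h x e) \<in> M \<Otimes>\<^sub>M P \<rightarrow>\<^sub>M S"
  shows "M \<bind> (\<lambda>x. distr P S (h x)) = distr (M \<Otimes>\<^sub>M P) S (\<lambda>(x, e). h x e)"
proof (rule measure_eqI)
  interpret prob_space P by fact
  have K: "(\<lambda>x. distr P S (h x)) \<in> M \<rightarrow>\<^sub>M subprob_algebra S"
    by (rule measurable_distr2[OF h]) (simp add: M_in_subprob)
  show "sets (M \<bind> (\<lambda>x. distr P S (h x))) = sets (distr (M \<Otimes>\<^sub>M P) S (\<lambda>(x, e). h x e))"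
    using M by simp
  fix X assume "X \<in> sets (M \<bind> (\<lambda>x. distr P S (h x)))"
  then have X[measurable]: "X \<in> sets S" using M by simp
  have hx: "h x \<in> P \<rightarrow>\<^sub>M S" if "x \<in> space M" for x
    using measurable_Pair2[OF h that] by simp
  have "emeasure (M \<bind> (\<lambda>x. distr P S (h x))) X = (\<integral>\<^sup>+x. emeasure (distr P S (h x)) X \<partial>M)"
    by (rule emeasure_bind[OF M K X])
  also have "\<dots> = (\<integral>\<^sup>+x. emeasure P (Pair x -` ((\<lambda>(x, e). h x e) -` X \<inter> space (M \<Otimes>\<^sub>M P))) \<partial>M)"
    by (intro nn_integral_cong, subst emeasure_distr[OF hx X])
       (auto simp: space_pair_measure intro!: arg_cong[where f="emeasure P"])
  also have "\<dots> = emeasure (M \<Otimes>\<^sub>M P) ((\<lambda>(x, e). h x e) -` X \<inter> space (M \<Otimes>\<^sub>M P))"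
    by (rule emeasure_pair_measure_alt[symmetric]) measurable
  also have "\<dots> = emeasure (distr (M \<Otimes>\<^sub>M P) S (\<lambda>(x, e). h x e)) X"
    by (rule emeasure_distr[OF h X, symmetric])
  finally show "emeasure (M \<bind> (\<lambda>x. distr P S (h x))) X = emeasure (distr (M \<Otimes>\<^sub>M P) S (\<lambda>(x, e). h x e)) X" .
qed

lemma distr_pair_map_fst:
  assumes "prob_space P" and f: "f \<in> M \<rightarrow>\<^sub>M MX" and j: "(\<lambda>(x, e). j x e) \<in> MX \<Otimes>\<^sub>M P \<rightarrow>\<^sub>M S"
  shows "distr (M \<Otimes>\<^sub>M P) S (\<lambda>(z, e). j (f z) e) = distr (distr M MX f \<Otimes>\<^sub>M P) S (\<lambda>(x, e). j x e)"
proof -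
  interpret prob_space P by fact
  have "distr M MX f \<Otimes>\<^sub>M P = distr M MX f \<Otimes>\<^sub>M distr P P (\<lambda>e. e)" by simp
  also have "\<dots> = distr (M \<Otimes>\<^sub>M P) (MX \<Otimes>\<^sub>M P) (\<lambda>(z, e). (f z, e))"
    by (intro pair_measure_distr f measurable_ident_sets refl) (simp add: sigma_finite_measure_axioms)
  finally have prod: "distr M MX f \<Otimes>\<^sub>M P = distr (M \<Otimes>\<^sub>M P) (MX \<Otimes>\<^sub>M P) (\<lambda>(z, e). (f z, e))" .
  have "(\<lambda>(z, e). (f z, e)) \<in> M \<Otimes>\<^sub>M P \<rightarrow>\<^sub>M MX \<Otimes>\<^sub>M P"
    using f by measurable
  then show ?thesis
    unfolding prod by (subst distr_distr[OF j]) (simp_all add: comp_def case_prod_beta')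
qed

abbreviation joint_space :: "((real^'n::finite) \<times> real) measure" where
  "joint_space \<equiv> state_measure \<Otimes>\<^sub>M borel"

lemma space_joint_space: "space joint_space = posvecs \<times> UNIV"
  by (simp add: space_pair_measure)

lemma measurable_state_emission:
  assumes "f \<in> M \<rightarrow>\<^sub>M state_measure" "g \<in> M \<rightarrow>\<^sub>M mixing_noise \<gamma>"
  shows "(\<lambda>z. (f z, emission (f z) (g z))) \<in> M \<rightarrow>\<^sub>M joint_space"
proof -
  have "g \<in> M \<rightarrow>\<^sub>M count_space UNIV \<Otimes>\<^sub>M borel"
    using assms(2) measurable_cong_sets[OF refl sets_mixing_noise] by blast
  then show ?thesis
    by (intro measurable_Pair assms measurable_emission measurable_state_borel[OF assms(1)])
qed

lemma measurable_nm_psi: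
  assumes \<theta>: "(\<gamma>, \<omega>, A, b) \<in> param_space"
  shows "(\<lambda>(x, y). nm_psi (\<gamma>, \<omega>, A, b) y x) \<in> joint_space \<rightarrow>\<^sub>M state_measure"
proof (rule measurable_state_measureI)
  have [measurable]: "fst \<in> borel_measurable (joint_space :: ((real^'n) \<times> real) measure)"
    by (rule measurable_state_borel) simp
  show "(\<lambda>(x, y). nm_psi (\<gamma>, \<omega>, A, b) y x) \<in> borel_measurable joint_space"
    by (rule borel_measurable_vecI)
       (simp add: nm_psi_def case_prod_beta matrix_vector_mult_def, measurable)
qed (use nm_psi_posvecs(2)[OF \<theta>] in \<open>auto simp: space_joint_space\<close>)

text \<open>The kernel forgets everything about the current pair except the updated state.\<close>

lemma nm_K_eq_distr:
  assumes \<theta>: "(\<gamma>, \<omega>, A, b) \<in> param_space" and x: "x \<in> posvecs"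
  shows "nm_K (\<gamma>, \<omega>, A, b) (x, y) = distr (mixing_noise \<gamma>) joint_space
    (\<lambda>e. (nm_psi (\<gamma>, \<omega>, A, b) y x, emission (nm_psi (\<gamma>, \<omega>, A, b) y x) e))"
proof -
  have \<gamma>: "\<gamma> \<in> simplex_weights" using \<theta> by (simp add: param_space_def)
  interpret prob_space "mixing_noise \<gamma>" by (rule prob_space_mixing_noise[OF \<gamma>])
  have em: "emission x \<in> mixing_noise \<gamma> \<rightarrow>\<^sub>M borel" for x by measurable
  define F where "F x' = distr (mixing_noise \<gamma>) joint_space (\<lambda>e. (x', emission x' e))" for x'
  have F: "F \<in> state_measure \<rightarrow>\<^sub>M subprob_algebra joint_space"
    unfolding F_def[abs_def] using measurable_state_emission[of fst "state_measure \<Otimes>\<^sub>M mixing_noise \<gamma>" snd \<gamma>]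
    by (intro measurable_distr2[where M="mixing_noise \<gamma>"]) (simp_all add: case_prod_beta M_in_subprob)
  have F_eq: "nm_G (\<gamma>, \<omega>, A, b) x' \<bind> (\<lambda>y'. return joint_space (x', y')) = F x'" if "x' \<in> posvecs" for x'
  proof -
    have [measurable]: "x' \<in> space state_measure" using that by simp
    have "nm_G (\<gamma>, \<omega>, A, b) x' \<bind> (\<lambda>y'. return joint_space (x', y'))
      = distr (distr (mixing_noise \<gamma>) borel (emission x')) joint_space (\<lambda>y'. (x', y'))"
      unfolding nm_G_eq_distr[OF \<gamma> that] by (rule bind_return_distr') auto
    also have "\<dots> = F x'"
      unfolding F_def by (subst distr_distr[OF _ em]) (auto simp: comp_def)
    finally show ?thesis .
  qed
  have "nm_K (\<gamma>, \<omega>, A, b) (x, y) = return state_measure (nm_psi (\<gamma>, \<omega>, A, b) y x) \<bind> F"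
    unfolding nm_K_def od_kernel_def prod.case by (intro bind_cong refl F_eq) simp
  also have "\<dots> = F (nm_psi (\<gamma>, \<omega>, A, b) y x)"
    by (rule bind_return[OF F]) (simp add: nm_psi_posvecs(2)[OF \<theta> x])
  finally show ?thesis by (simp add: F_def)
qed

definition joint_law :: "real^'n::finite \<Rightarrow> (real^'n) measure \<Rightarrow> ((real^'n) \<times> real) measure" where
  "joint_law \<gamma> \<mu> = distr (\<mu> \<Otimes>\<^sub>M mixing_noise \<gamma>) joint_space (\<lambda>(x, e). (x, emission x e))"

lemma measurable_joint_law_map:
  assumes "sets \<mu> = sets state_measure"
  shows "(\<lambda>(x, e). (x, emission x e)) \<in> \<mu> \<Otimes>\<^sub>M mixing_noise \<gamma> \<rightarrow>\<^sub>M joint_space"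
proof -
  have "fst \<in> \<mu> \<Otimes>\<^sub>M mixing_noise \<gamma> \<rightarrow>\<^sub>M state_measure"
    using measurable_cong_sets[OF refl assms] measurable_fst by blast
  from measurable_state_emission[OF this measurable_snd] show ?thesis
    by (simp add: case_prod_beta)
qed

lemma prob_space_joint_law:
  assumes \<gamma>: "\<gamma> \<in> simplex_weights" and \<mu>: "prob_space \<mu>" "sets \<mu> = sets state_measure"
  shows "prob_space (joint_law \<gamma> \<mu>)"
  unfolding joint_law_def
  by (intro prob_space.prob_space_distr prob_space_pair \<mu>(1) prob_space_mixing_noise[OF \<gamma>]
      measurable_joint_law_map[OF \<mu>(2)])

lemma distr_joint_law_fst:
  assumes \<gamma>: "\<gamma> \<in> simplex_weights" and \<mu>: "sets \<mu> = sets state_measure"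
  shows "distr (joint_law \<gamma> \<mu>) state_measure fst = \<mu>"
proof -
  interpret prob_space "mixing_noise \<gamma>" by (rule prob_space_mixing_noise[OF \<gamma>])
  have "distr (joint_law \<gamma> \<mu>) state_measure fst = distr (\<mu> \<Otimes>\<^sub>M mixing_noise \<gamma>) state_measure fst"
    unfolding joint_law_def
    by (subst distr_distr[OF _ measurable_joint_law_map[OF \<mu>]]) (auto simp: comp_def case_prod_beta)
  also have "\<dots> = distr (\<mu> \<Otimes>\<^sub>M mixing_noise \<gamma>) \<mu> fst"
    by (rule distr_cong) (simp_all add: \<mu>)
  also have "\<dots> = \<mu>" by (rule distr_pair_fst)
  finally show ?thesis .
qed

lemma distr_joint_law_psi:
  assumes \<theta>: "(\<gamma>, \<omega>, A, b) \<in> param_space" and \<mu>: "sets \<mu> = sets state_measure"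
  shows "distr (joint_law \<gamma> \<mu>) state_measure (\<lambda>(x, y). nm_psi (\<gamma>, \<omega>, A, b) y x)
    = distr (\<mu> \<Otimes>\<^sub>M mixing_noise \<gamma>) state_measure (\<lambda>(x, e). \<omega> + noise_matrix A b e *v x)"
proof -
  have "space \<mu> = posvecs" using sets_eq_imp_space_eq[OF \<mu>] by simp
  then show ?thesis
    unfolding joint_law_def
    by (subst distr_distr[OF measurable_nm_psi[OF \<theta>] measurable_joint_law_map[OF \<mu>]], intro distr_cong)
       (auto simp: space_pair_measure nm_psi_emission)
qed

lemma bind_nm_K:
  assumes \<theta>: "(\<gamma>, \<omega>, A, b) \<in> param_space" and \<pi>: "prob_space \<pi>" "sets \<pi> = sets joint_space"
  shows "\<pi> \<bind> nm_K (\<gamma>, \<omega>, A, b)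
    = joint_law \<gamma> (distr \<pi> state_measure (\<lambda>(x, y). nm_psi (\<gamma>, \<omega>, A, b) y x))"
proof -
  have \<gamma>: "\<gamma> \<in> simplex_weights" using \<theta> by (simp add: param_space_def)
  note P = prob_space_mixing_noise[OF \<gamma>]
  let ?\<psi> = "\<lambda>(x, y). nm_psi (\<gamma>, \<omega>, A, b) y x"
  have \<psi>: "?\<psi> \<in> \<pi> \<rightarrow>\<^sub>M state_measure"
    using measurable_nm_psi[OF \<theta>] measurable_cong_sets[OF \<pi>(2) refl] by blast
  have space: "space \<pi> = posvecs \<times> UNIV"
    using sets_eq_imp_space_eq[OF \<pi>(2)] by (simp add: space_joint_space)
  have "\<pi> \<bind> nm_K (\<gamma>, \<omega>, A, b)
    = \<pi> \<bind> (\<lambda>z. distr (mixing_noise \<gamma>) joint_space (\<lambda>e. (?\<psi> z, emission (?\<psi> z) e)))"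
    by (intro bind_cong refl) (auto simp: space nm_K_eq_distr[OF \<theta>])
  also have "\<dots> = distr (\<pi> \<Otimes>\<^sub>M mixing_noise \<gamma>) joint_space (\<lambda>(z, e). (?\<psi> z, emission (?\<psi> z) e))"
    using measurable_state_emission[OF measurable_compose[OF measurable_fst \<psi>] measurable_snd]
    by (intro bind_distr_kernel P prob_space.not_empty \<pi>) (simp add: case_prod_beta)
  also have "\<dots> = joint_law \<gamma> (distr \<pi> state_measure ?\<psi>)"
    unfolding joint_law_def
    by (intro distr_pair_map_fst[OF P \<psi>, where j="\<lambda>x e. (x, emission x e)"] measurable_joint_law_map refl)
  finally show ?thesis .
qed

text \<open>One step of the kernel turns any law into the joint law of its updated state (\<open>bind_nm_K\<close>), so a
stationary law is a \<open>joint_law\<close> of some \<open>\<mu>\<close>; updating the state under that law is one step of the recursion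
started from \<open>\<mu>\<close>.\<close>

lemma stationary_nm_K_iff:
  assumes \<theta>: "(\<gamma>, \<omega>, A, b) \<in> param_space"
    and "positive_affine_recursion (mixing_noise \<gamma>) (noise_matrix A b) \<omega> w \<rho>"
  shows "stationary_distribution joint_space (nm_K (\<gamma>, \<omega>, A, b)) \<pi> \<longleftrightarrow>
    (\<exists>\<mu>. positive_affine_recursion.invariant (mixing_noise \<gamma>) (noise_matrix A b) \<omega> \<mu> \<and> \<pi> = joint_law \<gamma> \<mu>)"
proof -
  interpret positive_affine_recursion "mixing_noise \<gamma>" "noise_matrix A b" \<omega> w \<rho> by fact
  have \<gamma>: "\<gamma> \<in> simplex_weights" using \<theta> by (simp add: param_space_def)
  let ?\<psi> = "\<lambda>(x, y). nm_psi (\<gamma>, \<omega>, A, b) y x"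
  have next_state: "distr (joint_law \<gamma> \<mu>) state_measure ?\<psi>
      = distr (\<mu> \<Otimes>\<^sub>M mixing_noise \<gamma>) state_measure (\<lambda>(x, e). step x e)"
    if "sets \<mu> = sets state_measure" for \<mu>
    unfolding step_def by (rule distr_joint_law_psi[OF \<theta> that])
  show ?thesis
  proof
    assume "stationary_distribution joint_space (nm_K (\<gamma>, \<omega>, A, b)) \<pi>"
    then have \<pi>: "prob_space \<pi>" "sets \<pi> = sets joint_space" "\<pi> \<bind> nm_K (\<gamma>, \<omega>, A, b) = \<pi>"
      by (auto simp: stationary_distribution_def)
    define \<mu> where "\<mu> = distr \<pi> state_measure ?\<psi>"
    have "?\<psi> \<in> \<pi> \<rightarrow>\<^sub>M state_measure"
      using measurable_nm_psi[OF \<theta>] measurable_cong_sets[OF \<pi>(2) refl] by blast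
    then have \<mu>: "prob_space \<mu>" "sets \<mu> = sets state_measure"
      unfolding \<mu>_def by (simp_all add: prob_space.prob_space_distr[OF \<pi>(1)])
    have eq: "\<pi> = joint_law \<gamma> \<mu>"
      unfolding \<mu>_def using bind_nm_K[OF \<theta> \<pi>(1,2)] \<pi>(3) by simp
    have "distr (\<mu> \<Otimes>\<^sub>M mixing_noise \<gamma>) state_measure (\<lambda>(x, e). step x e) = \<mu>"
      using next_state[OF \<mu>(2)] unfolding eq[symmetric] \<mu>_def[symmetric] by simp
    with eq \<mu> show "\<exists>\<mu>. invariant \<mu> \<and> \<pi> = joint_law \<gamma> \<mu>" by (auto simp: invariant_def)
  next
    assume "\<exists>\<mu>. invariant \<mu> \<and> \<pi> = joint_law \<gamma> \<mu>"
    then obtain \<mu> where "invariant \<mu>" and eq: "\<pi> = joint_law \<gamma> \<mu>" by blast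
    then have \<mu>: "prob_space \<mu>" "sets \<mu> = sets state_measure"
      "distr (\<mu> \<Otimes>\<^sub>M mixing_noise \<gamma>) state_measure (\<lambda>(x, e). step x e) = \<mu>"
      by (auto simp: invariant_def)
    have J: "prob_space (joint_law \<gamma> \<mu>)" "sets (joint_law \<gamma> \<mu>) = sets joint_space"
      using prob_space_joint_law[OF \<gamma> \<mu>(1,2)] by (simp_all add: joint_law_def)
    have "joint_law \<gamma> \<mu> \<bind> nm_K (\<gamma>, \<omega>, A, b) = joint_law \<gamma> \<mu>"
      unfolding bind_nm_K[OF \<theta> J] next_state[OF \<mu>(2)] \<mu>(3) ..
    with J show "stationary_distribution joint_space (nm_K (\<gamma>, \<omega>, A, b)) \<pi>"
      unfolding eq stationary_distribution_def by blast
  qed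
qed

section \<open>Contraction and regularity uniformly in the parameter\<close>

lemma is_norm_equivalent:
  fixes V :: "real^'n::finite \<Rightarrow> real"
  assumes "is_norm V"
  obtains c C where "0 < c" "0 < C" "\<And>x. c * norm x \<le> V x" "\<And>x. V x \<le> C * norm x"
proof -
  have nn: "\<And>x. 0 \<le> V x" and zero: "\<And>x. V x = 0 \<longleftrightarrow> x = 0"
    and scale: "\<And>c x. V (c *\<^sub>R x) = \<bar>c\<bar> * V x" and tri: "\<And>x y. V (x + y) \<le> V x + V y"
    using assms by (auto simp: is_norm_def)
  define C where "C = (\<Sum>i\<in>UNIV. V (axis i 1)) + 1"
  have "0 < C" unfolding C_def by (intro add_nonneg_pos sum_nonneg nn) simp
  have sum: "V (sum f S) \<le> (\<Sum>i\<in>S. V (f i))" if "finite S" for f and S :: "'n set"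
    using that
  proof induction
    case empty then show ?case using zero[of 0] by simp
  next
    case (insert i S)
    then show ?case using tri[of "f i" "sum f S"] by simp
  qed
  have upper: "V x \<le> C * norm x" for x
  proof -
    have "V x = V (\<Sum>i\<in>UNIV. x $ i *\<^sub>R axis i 1)"
      using basis_expansion[of x] by (simp add: scalar_mult_eq_scaleR)
    also have "\<dots> \<le> (\<Sum>i\<in>UNIV. \<bar>x $ i\<bar> * V (axis i 1))"
      using sum[of UNIV "\<lambda>i. x $ i *\<^sub>R axis i 1"] by (simp add: scale)
    also have "\<dots> \<le> (\<Sum>i\<in>UNIV. norm x * V (axis i 1))"
      by (intro sum_mono mult_right_mono component_le_norm_cart nn)
    also have "\<dots> \<le> C * norm x"
      by (simp add: C_def algebra_simps sum_distrib_left)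
    finally show ?thesis .
  qed
  have "V x \<le> V y + C * norm (x - y)" for x y
    using tri[of "x - y" y] upper[of "x - y"] by simp
  then have lip: "\<bar>V x - V y\<bar> \<le> C * norm (x - y)" for x y
    by (smt (verit) norm_minus_commute)
  then have "C-lipschitz_on UNIV V"
    using \<open>0 < C\<close> by (intro lipschitz_onI) (auto simp: dist_norm)
  then have "continuous_on (sphere 0 1) V"
    by (rule continuous_on_subset[OF lipschitz_on_continuous_on]) simp
  moreover have "axis undefined 1 \<in> sphere (0 :: real^'n) 1" by simp
  ultimately obtain z where z: "z \<in> sphere 0 1" "\<And>x. x \<in> sphere 0 1 \<Longrightarrow> V z \<le> V x"
    using continuous_attains_inf[OF compact_sphere] by (metis empty_iff)
  have "0 < V z" using z(1) nn[of z] zero[of z] by force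
  have lower: "V z * norm x \<le> V x" for x
  proof (cases "x = 0")
    case False
    have "V z \<le> V ((1 / norm x) *\<^sub>R x)" by (rule z) (use False in simp)
    then show ?thesis using False by (simp add: scale field_simps)
  qed (simp add: nn)
  show ?thesis by (rule that[OF \<open>0 < V z\<close> \<open>0 < C\<close> lower upper])
qed

lemma wnorm_matrix_power_le:
  fixes A :: "real^'n::finite^'n"
  assumes w: "\<And>i. 0 < w $ i" and A: "\<And>i j. 0 \<le> A $ i $ j" and "0 \<le> \<rho>"
    and sub: "\<And>j. (\<Sum>i\<in>UNIV. w $ i * A $ i $ j) \<le> \<rho> * w $ j"
  shows "wnorm w (((*v) A ^^ n) v) \<le> \<rho> ^ n * wnorm w v"
proof (induction n)
  case (Suc n)
  have one: "wnorm w (A *v u) \<le> \<rho> * wnorm w u" for u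
  proof -
    have "wnorm w (A *v u) \<le> (\<Sum>j\<in>UNIV. (\<Sum>i\<in>UNIV. w $ i * A $ i $ j) * \<bar>u $ j\<bar>)"
      by (rule wnorm_matrix_vector_mult_le[OF w A])
    also have "\<dots> \<le> (\<Sum>j\<in>UNIV. \<rho> * w $ j * \<bar>u $ j\<bar>)"
      by (intro sum_mono mult_right_mono sub) simp
    finally show ?thesis by (simp add: wnorm_def sum_distrib_left mult.assoc)
  qed
  from one[of "((*v) A ^^ n) v"] mult_left_mono[OF Suc \<open>0 \<le> \<rho>\<close>]
  show ?case by (simp add: mult.assoc)
qed simp

text \<open>The set \<open>U (w, \<rho>)\<close> of parameters for which \<open>w\<close> is a left subsolution with factor \<open>\<rho>\<close> is open, and
these sets cover \<open>\<Theta>\<close>. Norms that belong to different \<open>w\<close> are compared with the Euclidean norm, at the cost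
of a factor that does not depend on the power.\<close>

lemma uniform_contraction:
  fixes \<Theta> :: "'n::finite param set"
  assumes "compact \<Theta>" "\<Theta> \<subseteq> param_space"
    and spec: "\<forall>(\<gamma>, \<omega>, A, b)\<in>\<Theta>. spec_radius (A + outer_prod b \<gamma>) < 1"
  obtains c \<rho> where "1 \<le> c" "0 < \<rho>" "\<rho> < 1"
    "\<And>\<gamma> \<omega> A b n v. (\<gamma>, \<omega>, A, b) \<in> \<Theta> \<Longrightarrow> norm (((*v) A ^^ n) v) \<le> c * \<rho> ^ n * norm v"
proof -
  define I :: "((real^'n) \<times> real) set" where "I = {(w, \<rho>). (\<forall>i. 0 < w $ i) \<and> 0 < \<rho> \<and> \<rho> < 1}"
  define U :: "(real^'n) \<times> real \<Rightarrow> 'n param set" where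
    "U = (\<lambda>(w, \<rho>). {(\<gamma>, \<omega>, A, b). \<forall>j. (\<Sum>i\<in>UNIV. w $ i * (A + outer_prod b \<gamma>) $ i $ j) < \<rho> * w $ j})"
  have "open (U p)" for p
  proof -
    have "U p = (\<Inter>j. {\<theta>. (\<Sum>i\<in>UNIV. fst p $ i * (fst (snd (snd \<theta>)) $ i $ j + snd (snd (snd \<theta>)) $ i * fst \<theta> $ j)) < snd p * fst p $ j})"
      by (auto simp: U_def outer_prod_def case_prod_beta)
    also have "open \<dots>"
      by (intro open_INT open_Collect_less continuous_intros ballI) auto
    finally show ?thesis .
  qed
  moreover have "\<Theta> \<subseteq> (\<Union>p\<in>I. U p)"
  proof
    fix \<theta> assume "\<theta> \<in> \<Theta>"
    obtain \<gamma> \<omega> A b where \<theta>: "\<theta> = (\<gamma>, \<omega>, A, b)" by (cases \<theta>) auto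
    have "0 \<le> (A + outer_prod b \<gamma>) $ i $ j" for i j
      using \<open>\<theta> \<in> \<Theta>\<close> assms(2) \<theta> by (auto simp: param_space_def simplex_weights_def nonnegvecs_def outer_prod_def)
    moreover have "spec_radius (A + outer_prod b \<gamma>) < 1" using \<open>\<theta> \<in> \<Theta>\<close> spec \<theta> by auto
    ultimately obtain w \<rho> where "\<And>i. 0 < w $ i" "0 < \<rho>" "\<rho> < 1"
      "\<And>j. (\<Sum>i\<in>UNIV. w $ i * (A + outer_prod b \<gamma>) $ i $ j) < \<rho> * w $ j"
      using positive_left_subsolution_strict by blast
    then have "(w, \<rho>) \<in> I" "\<theta> \<in> U (w, \<rho>)" by (auto simp: I_def U_def \<theta>)
    then show "\<theta> \<in> (\<Union>p\<in>I. U p)" by blast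
  qed
  ultimately obtain F where F: "F \<subseteq> I" "finite F" "\<Theta> \<subseteq> (\<Union>p\<in>F. U p)"
    using compactE_image[OF assms(1), of I U] by blast
  have "\<exists>c\<ge>1. \<forall>(\<gamma>, \<omega>, A, b)\<in>U p \<inter> param_space. \<forall>n v. norm (((*v) A ^^ n) v) \<le> c * snd p ^ n * norm v"
    if "p \<in> I" for p
  proof -
    obtain w \<rho> where p: "p = (w, \<rho>)" by (cases p)
    have w: "\<And>i. 0 < w $ i" and \<rho>: "0 < \<rho>" "\<rho> < 1" using that by (auto simp: p I_def)
    obtain c where c: "0 < c" "\<And>x. norm x \<le> c * wnorm w x" using norm_le_wnorm[OF w] by blast
    define W where "W = (\<Sum>i\<in>UNIV. w $ i)"
    have "norm (((*v) A ^^ n) v) \<le> max 1 (c * W) * \<rho> ^ n * norm v"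
      if "(\<gamma>, \<omega>, A, b) \<in> U p" "(\<gamma>, \<omega>, A, b) \<in> param_space" for \<gamma> \<omega> A b n v
    proof -
      have nn: "0 \<le> A $ i $ j" "0 \<le> b $ i" "0 \<le> \<gamma> $ j" for i j
        using that(2) by (auto simp: param_space_def simplex_weights_def nonnegvecs_def)
      have "(\<Sum>i\<in>UNIV. w $ i * A $ i $ j) \<le> \<rho> * w $ j" for j
      proof -
        have "(\<Sum>i\<in>UNIV. w $ i * A $ i $ j) \<le> (\<Sum>i\<in>UNIV. w $ i * (A + outer_prod b \<gamma>) $ i $ j)"
          by (intro sum_mono mult_left_mono less_imp_le[OF w]) (simp add: outer_prod_def nn)
        also have "\<dots> \<le> \<rho> * w $ j" using that(1) by (auto simp: U_def p less_imp_le)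
        finally show ?thesis .
      qed
      then have "wnorm w (((*v) A ^^ n) v) \<le> \<rho> ^ n * wnorm w v"
        by (intro wnorm_matrix_power_le w nn less_imp_le[OF \<rho>(1)])
      also have "\<dots> \<le> \<rho> ^ n * (W * norm v)"
        unfolding W_def using \<rho> by (intro mult_left_mono wnorm_le_norm w) auto
      finally have "c * wnorm w (((*v) A ^^ n) v) \<le> c * (\<rho> ^ n * (W * norm v))"
        using c(1) by (intro mult_left_mono) auto
      with c(2)[of "((*v) A ^^ n) v"] have "norm (((*v) A ^^ n) v) \<le> (c * W) * (\<rho> ^ n * norm v)"
        by (simp add: ac_simps)
      also have "\<dots> \<le> max 1 (c * W) * (\<rho> ^ n * norm v)"
        using \<rho> by (intro mult_right_mono) auto
      finally show ?thesis by (simp add: mult.assoc)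
    qed
    then show ?thesis by (intro exI[of _ "max 1 (c * W)"]) (auto simp: p)
  qed
  then obtain C where C: "\<And>p. p \<in> I \<Longrightarrow> 1 \<le> C p"
    "\<And>p \<gamma> \<omega> A b n v. p \<in> I \<Longrightarrow> (\<gamma>, \<omega>, A, b) \<in> U p \<Longrightarrow> (\<gamma>, \<omega>, A, b) \<in> param_space \<Longrightarrow>
      norm (((*v) A ^^ n) v) \<le> C p * snd p ^ n * norm v"
    by (metis (mono_tags, lifting) IntI case_prodD)
  \<comment> \<open>The inserted elements keep the maxima meaningful when the cover is empty.\<close>
  define c where "c = Max (insert 1 (C ` F))"
  define \<rho> where "\<rho> = Max (insert (1 / 2) (snd ` F))"
  have "1 \<le> c" unfolding c_def using F by (intro Max_ge) auto
  have c: "C p \<le> c" if "p \<in> F" for p unfolding c_def using F that by (intro Max_ge) auto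
  have \<rho>': "snd p \<le> \<rho>" if "p \<in> F" for p unfolding \<rho>_def using F that by (intro Max_ge) auto
  have "1 / 2 \<le> \<rho>" unfolding \<rho>_def using F by (intro Max_ge) auto
  have "\<rho> \<in> insert (1 / 2) (snd ` F)" unfolding \<rho>_def using F by (intro Max_in) auto
  then have "\<rho> < 1" using F(1) by (auto simp: I_def)
  have "norm (((*v) A ^^ n) v) \<le> c * \<rho> ^ n * norm v" if "(\<gamma>, \<omega>, A, b) \<in> \<Theta>" for \<gamma> \<omega> A b n v
  proof -
    from that F(3) obtain p where p: "p \<in> F" "(\<gamma>, \<omega>, A, b) \<in> U p" by blast
    have "p \<in> I" using p F by blast
    have "norm (((*v) A ^^ n) v) \<le> C p * snd p ^ n * norm v"
      using C(2)[OF \<open>p \<in> I\<close> p(2)] that assms(2) by blast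
    also have "\<dots> \<le> c * \<rho> ^ n * norm v"
      using c[OF p(1)] \<rho>'[OF p(1)] \<open>p \<in> I\<close> C(1)[OF \<open>p \<in> I\<close>]
      by (intro mult_right_mono mult_mono power_mono) (auto simp: I_def)
    finally show ?thesis .
  qed
  then show ?thesis using \<open>1 \<le> c\<close> \<open>1 / 2 \<le> \<rho>\<close> \<open>\<rho> < 1\<close> by (intro that[of c \<rho>]) auto
qed

lemma nm_psi_iter_diff:
  "nm_psi_iter (\<gamma>, \<omega>, A, b) ys x - nm_psi_iter (\<gamma>, \<omega>, A, b) ys x' = ((*v) A ^^ length ys) (x - x')"
proof (induction ys arbitrary: x x')
  case (Cons y ys)
  have "nm_psi (\<gamma>, \<omega>, A, b) y x - nm_psi (\<gamma>, \<omega>, A, b) y x' = A *v (x - x')"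
    by (simp add: nm_psi_def matrix_vector_mult_diff_distrib)
  with Cons[of "nm_psi (\<gamma>, \<omega>, A, b) y x" "nm_psi (\<gamma>, \<omega>, A, b) y x'"] show ?case
    by (simp add: nm_psi_iter_def funpow_swap1)
qed (simp add: nm_psi_iter_def)

text \<open>The log density in the variance \<open>u\<close> is \<open>- y\<^sup>2 / (2 u) - ln (2 pi u) / 2\<close>; for \<open>u \<ge> m\<close> its derivative is
bounded by the factor in front of \<open>\<bar>s - t\<bar>\<close>.\<close>

lemma gaussian_density_le:
  fixes y :: real
  assumes "0 < m" "m \<le> s" "m \<le> t"
  shows "exp (- (y\<^sup>2 / (2 * s))) / sqrt (2 * pi * s)
    \<le> exp ((1 / (2 * m) + y\<^sup>2 / (2 * m\<^sup>2)) * \<bar>s - t\<bar>) * (exp (- (y\<^sup>2 / (2 * t))) / sqrt (2 * pi * t))"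
proof -
  have st: "0 < s" "0 < t" using assms by auto
  have form: "exp (- (y\<^sup>2 / (2 * u))) / sqrt (2 * pi * u) = exp (- (y\<^sup>2 / (2 * u)) - (ln (2 * pi) + ln u) / 2)" if "0 < u" for u
  proof -
    have "sqrt (2 * pi * u) = exp (ln (sqrt (2 * pi * u)))" using that by (intro exp_ln[symmetric]) simp
    also have "ln (sqrt (2 * pi * u)) = (ln (2 * pi) + ln u) / 2"
      using that by (simp add: ln_sqrt ln_mult)
    finally show ?thesis by (simp add: exp_diff)
  qed
  have "1 / t - 1 / s \<le> \<bar>s - t\<bar> / m\<^sup>2"
  proof -
    have "1 / t - 1 / s = (s - t) / (s * t)" using st by (simp add: field_simps)
    also have "\<dots> \<le> \<bar>s - t\<bar> / (s * t)" using st by (intro divide_right_mono) auto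
    also have "\<dots> \<le> \<bar>s - t\<bar> / m\<^sup>2"
      unfolding power2_eq_square using assms by (intro divide_left_mono mult_mono) auto
    finally show ?thesis .
  qed
  from mult_left_mono[OF this, of "y\<^sup>2 / 2"]
  have 1: "y\<^sup>2 / (2 * t) - y\<^sup>2 / (2 * s) \<le> y\<^sup>2 / (2 * m\<^sup>2) * \<bar>s - t\<bar>"
    by (simp add: right_diff_distrib)
  have 2: "ln t - ln s \<le> \<bar>s - t\<bar> / m"
  proof -
    have "ln t - ln s = ln (t / s)" using st by (simp add: ln_div)
    also have "\<dots> \<le> t / s - 1" using st by (intro ln_le_minus_one) simp
    also have "\<dots> = (t - s) / s" using st by (simp add: field_simps)
    also have "\<dots> \<le> \<bar>s - t\<bar> / s" using st by (intro divide_right_mono) auto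
    also have "\<dots> \<le> \<bar>s - t\<bar> / m" using assms by (intro divide_left_mono) auto
    finally show ?thesis .
  qed
  then have "ln t / 2 - ln s / 2 \<le> 1 / (2 * m) * \<bar>s - t\<bar>" by simp
  with 1 have "- (y\<^sup>2 / (2 * s)) - (ln (2 * pi) + ln s) / 2
      \<le> (1 / (2 * m) + y\<^sup>2 / (2 * m\<^sup>2)) * \<bar>s - t\<bar> + (- (y\<^sup>2 / (2 * t)) - (ln (2 * pi) + ln t) / 2)"
    unfolding distrib_right add_divide_distrib by linarith
  then show ?thesis unfolding form[OF st(1)] form[OF st(2)] by (simp flip: exp_add)
qed

lemma nm_g_pos:
  assumes \<gamma>: "\<gamma> \<in> simplex_weights" and x: "x \<in> posvecs"
  shows "0 < nm_g (\<gamma>, \<omega>, A, b) x y"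
proof -
  have p: "0 < exp (- (y\<^sup>2 / (2 * x $ l))) / sqrt (2 * pi * x $ l)" for l
    using x by (simp add: posvecs_def)
  have "\<exists>l. \<gamma> $ l \<noteq> 0"
    using simplex_weightsD(2)[OF \<gamma>] by (metis sum.neutral zero_neq_one)
  then obtain l where "0 < \<gamma> $ l"
    using simplex_weightsD(1)[OF \<gamma>] by (metis order_le_less)
  then show ?thesis
    unfolding nm_g_def prod.case
    using p simplex_weightsD(1)[OF \<gamma>] by (intro sum_pos2[of _ l] mult_pos_pos mult_nonneg_nonneg) (auto simp: less_imp_le)
qed

text \<open>A bound on the ratio that holds for every component passes to the mixture, also when some weights
vanish.\<close>

lemma nm_g_le:
  assumes \<gamma>: "\<gamma> \<in> simplex_weights" and m: "0 < m" and x: "\<And>i. m \<le> x $ i" "\<And>i. m \<le> x' $ i"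
  shows "nm_g (\<gamma>, \<omega>, A, b) x y \<le> exp ((1 / (2 * m) + y\<^sup>2 / (2 * m\<^sup>2)) * norm (x - x')) * nm_g (\<gamma>, \<omega>, A, b) x' y"
proof -
  let ?p = "\<lambda>s. exp (- (y\<^sup>2 / (2 * s))) / sqrt (2 * pi * s)"
  let ?k = "1 / (2 * m) + y\<^sup>2 / (2 * m\<^sup>2)"
  have p: "?p (x $ l) \<le> exp (?k * norm (x - x')) * ?p (x' $ l)" for l
  proof -
    have "?p (x $ l) \<le> exp (?k * \<bar>x $ l - x' $ l\<bar>) * ?p (x' $ l)"
      by (rule gaussian_density_le[OF m x])
    also have "\<dots> \<le> exp (?k * norm (x - x')) * ?p (x' $ l)"
      using m x(2)[of l] component_le_norm_cart[of "x - x'" l]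
      by (intro mult_right_mono) (auto intro!: mult_left_mono)
    finally show ?thesis .
  qed
  have "nm_g (\<gamma>, \<omega>, A, b) x y \<le> (\<Sum>l\<in>UNIV. \<gamma> $ l * (exp (?k * norm (x - x')) * ?p (x' $ l)))"
    unfolding nm_g_def prod.case by (intro sum_mono mult_left_mono p simplex_weightsD(1)[OF \<gamma>])
  also have "\<dots> = exp (?k * norm (x - x')) * nm_g (\<gamma>, \<omega>, A, b) x' y"
    by (simp add: nm_g_def sum_distrib_left ac_simps)
  finally show ?thesis .
qed

lemma ln_nm_g_ratio_le:
  assumes \<gamma>: "\<gamma> \<in> simplex_weights" and m: "0 < m" and x: "\<And>i. m \<le> x $ i" "\<And>i. m \<le> x' $ i"
  shows "\<bar>ln (nm_g (\<gamma>, \<omega>, A, b) x y / nm_g (\<gamma>, \<omega>, A, b) x' y)\<bar>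
    \<le> (1 / (2 * m) + y\<^sup>2 / (2 * m\<^sup>2)) * norm (x - x')"
proof -
  have "x \<in> posvecs" "x' \<in> posvecs" using m x by (auto simp: posvecs_def intro: less_le_trans)
  then have pos: "0 < nm_g (\<gamma>, \<omega>, A, b) x y" "0 < nm_g (\<gamma>, \<omega>, A, b) x' y"
    using nm_g_pos[OF \<gamma>] by blast+
  have upper: "ln (nm_g (\<gamma>, \<omega>, A, b) u y) \<le> (1 / (2 * m) + y\<^sup>2 / (2 * m\<^sup>2)) * norm (u - v) + ln (nm_g (\<gamma>, \<omega>, A, b) v y)"
    if "0 < nm_g (\<gamma>, \<omega>, A, b) u y" "0 < nm_g (\<gamma>, \<omega>, A, b) v y" "\<And>i. m \<le> u $ i" "\<And>i. m \<le> v $ i" for u v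
  proof -
    have "ln (nm_g (\<gamma>, \<omega>, A, b) u y)
      \<le> ln (exp ((1 / (2 * m) + y\<^sup>2 / (2 * m\<^sup>2)) * norm (u - v)) * nm_g (\<gamma>, \<omega>, A, b) v y)"
      using nm_g_le[OF \<gamma> m that(3,4), of \<omega> A b y] that(1,2) by (intro ln_mono) auto
    also have "\<dots> = (1 / (2 * m) + y\<^sup>2 / (2 * m\<^sup>2)) * norm (u - v) + ln (nm_g (\<gamma>, \<omega>, A, b) v y)"
      using that(2) by (simp add: ln_mult)
    finally show ?thesis .
  qed
  show ?thesis
    using upper[OF pos x] upper[OF pos(2,1) x(2,1)] pos
    by (simp add: ln_div norm_minus_commute abs_le_iff)
qed

lemma nm_g_bounded:
  assumes \<gamma>: "\<gamma> \<in> simplex_weights" and m: "0 < m" and x: "\<And>i. m \<le> x $ i"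
  shows "nm_g (\<gamma>, \<omega>, A, b) x y \<le> 1 / sqrt (2 * pi * m)"
proof -
  have "exp (- (y\<^sup>2 / (2 * x $ l))) / sqrt (2 * pi * x $ l) \<le> 1 / sqrt (2 * pi * m)" for l
    using m x[of l] by (intro frac_le) auto
  then have "nm_g (\<gamma>, \<omega>, A, b) x y \<le> (\<Sum>l\<in>UNIV. \<gamma> $ l * (1 / sqrt (2 * pi * m)))"
    unfolding nm_g_def prod.case by (intro sum_mono mult_left_mono simplex_weightsD(1)[OF \<gamma>])
  also have "\<dots> = 1 / sqrt (2 * pi * m)"
    by (simp only: sum_distrib_right[symmetric] simplex_weightsD(2)[OF \<gamma>])
  finally show ?thesis .
qed

lemma nn_integral_square_nm_G:
  assumes \<gamma>: "\<gamma> \<in> simplex_weights" and x: "x \<in> posvecs"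
  shows "(\<integral>\<^sup>+y. ennreal (y\<^sup>2) \<partial>nm_G (\<gamma>, \<omega>, A, b) x) = ennreal (\<Sum>l\<in>UNIV. \<gamma> $ l * x $ l)"
proof -
  have nn: "0 \<le> x $ l" for l using x by (simp add: posvecs_def less_imp_le)
  have "(\<integral>\<^sup>+y. ennreal (y\<^sup>2) \<partial>nm_G (\<gamma>, \<omega>, A, b) x) = (\<integral>\<^sup>+e. ennreal ((emission x e)\<^sup>2) \<partial>mixing_noise \<gamma>)"
    unfolding nm_G_eq_distr[OF \<gamma> x] by (subst nn_integral_distr) auto
  also have "\<dots> = (\<Sum>l\<in>UNIV. ennreal (\<gamma> $ l) * (\<integral>\<^sup>+\<epsilon>. ennreal (0 + x $ l * \<epsilon>\<^sup>2) \<partial>std_normal_distribution))"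
    by (subst nn_integral_mixing_noise) (auto simp: emission_def power_mult_distrib nn)
  also have "\<dots> = (\<Sum>l\<in>UNIV. ennreal (\<gamma> $ l * x $ l))"
    using nn simplex_weightsD(1)[OF \<gamma>]
    by (intro sum.cong refl, subst nn_integral_std_normal_quadratic) (auto simp: ennreal_mult)
  also have "\<dots> = ennreal (\<Sum>l\<in>UNIV. \<gamma> $ l * x $ l)"
    using nn simplex_weightsD(1)[OF \<gamma>] by (intro sum_ennreal) auto
  finally show ?thesis .
qed

lemma ln_plus_le: "0 \<le> t \<Longrightarrow> ln_plus (1 + t) \<le> t"
  using ln_add_one_self_le_self[of t] by (simp add: ln_plus_def)

lemma nm_G_ln_plus_le:
  assumes \<gamma>: "\<gamma> \<in> simplex_weights" and x: "x \<in> posvecs"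
  shows "kernel_int (nm_G (\<gamma>, \<omega>, A, b)) (\<lambda>y. ln_plus (1 + y\<^sup>2)) x \<le> ennreal (norm x)"
proof -
  have "kernel_int (nm_G (\<gamma>, \<omega>, A, b)) (\<lambda>y. ln_plus (1 + y\<^sup>2)) x
    \<le> (\<integral>\<^sup>+y. ennreal (y\<^sup>2) \<partial>nm_G (\<gamma>, \<omega>, A, b) x)"
    unfolding kernel_int_def by (intro nn_integral_mono ennreal_leI ln_plus_le) simp
  also have "\<dots> = ennreal (\<Sum>l\<in>UNIV. \<gamma> $ l * x $ l)" by (rule nn_integral_square_nm_G[OF \<gamma> x])
  also have "\<dots> \<le> ennreal (\<Sum>l\<in>UNIV. \<gamma> $ l * norm x)"
    using component_le_norm_cart[of x]
    by (intro ennreal_leI sum_mono mult_left_mono simplex_weightsD(1)[OF \<gamma>]) (meson abs_le_D1)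
  also have "(\<Sum>l\<in>UNIV. \<gamma> $ l * norm x) = norm x"
    by (simp only: sum_distrib_right[symmetric] simplex_weightsD(2)[OF \<gamma>] mult_1)
  finally show ?thesis .
qed

lemma continuous_on_nm_g:
  fixes \<Theta> :: "'n::finite param set"
  shows "continuous_on (\<Theta> \<times> posvecs) (\<lambda>(\<theta>, x). nm_g \<theta> x y)"
proof -
  have eq: "(\<lambda>(\<theta> :: 'n param, x). nm_g \<theta> x y) = (\<lambda>p. \<Sum>l\<in>UNIV. fst (fst p) $ l *
    (exp (- (y\<^sup>2 / (2 * snd p $ l))) / sqrt (2 * pi * snd p $ l)))"
    by (auto simp: nm_g_def)
  show ?thesis
    unfolding eq by (intro continuous_intros, auto simp: posvecs_def less_imp_neq[THEN not_sym])
qed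

lemma continuous_on_nm_psi:
  fixes S :: "('n::finite param \<times> (real^'n)) set"
  shows "continuous_on S (\<lambda>(\<theta>, x). nm_psi \<theta> y x)"
proof -
  have eq: "(\<lambda>(\<theta> :: 'n param, x). nm_psi \<theta> y x) = (\<lambda>p. fst (snd (fst p)) +
    (\<chi> i. \<Sum>j\<in>UNIV. fst (snd (snd (fst p))) $ i $ j * snd p $ j) + y\<^sup>2 *\<^sub>R snd (snd (snd (fst p))))"
    by (auto simp: nm_psi_def matrix_vector_mult_def)
  show ?thesis
    unfolding eq by (intro continuous_intros)
qed

lemma nm_recursion:
  fixes A :: "real^'n::finite^'n"
  assumes \<theta>: "(\<gamma>, \<omega>, A, b) \<in> param_space" and "spec_radius (A + outer_prod b \<gamma>) < 1"
  obtains w \<rho> where "positive_affine_recursion (mixing_noise \<gamma>) (noise_matrix A b) \<omega> w \<rho>"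
proof -
  have "0 \<le> (A + outer_prod b \<gamma>) $ i $ j" for i j
    using \<theta> by (auto simp: param_space_def simplex_weights_def nonnegvecs_def outer_prod_def)
  then obtain w :: "real^'n" and \<rho> where "\<And>i. 0 < w $ i" "0 < \<rho>" "\<rho> < 1"
    "\<And>j. (\<Sum>i\<in>UNIV. w $ i * (A + outer_prod b \<gamma>) $ i $ j) < \<rho> * w $ j"
    using positive_left_subsolution_strict assms(2) by blast
  then show ?thesis
    by (intro that recursion_mixing_noise[OF \<theta>]) (auto simp: less_imp_le)
qed

lemma nm_stationary:
  fixes A :: "real^'n::finite^'n"
  assumes \<theta>: "(\<gamma>, \<omega>, A, b) \<in> param_space" and "spec_radius (A + outer_prod b \<gamma>) < 1" and V: "is_norm V"
  shows "\<exists>!\<pi>. stationary_distribution joint_space (nm_K (\<gamma>, \<omega>, A, b)) \<pi>"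
    and "stationary_distribution joint_space (nm_K (\<gamma>, \<omega>, A, b)) \<pi> \<Longrightarrow>
      (\<integral>\<^sup>+x. ennreal (V x) \<partial>distr \<pi> state_measure fst) < \<infinity>"
proof -
  obtain w \<rho> where R: "positive_affine_recursion (mixing_noise \<gamma>) (noise_matrix A b) \<omega> w \<rho>"
    using nm_recursion assms by blast
  interpret positive_affine_recursion "mixing_noise \<gamma>" "noise_matrix A b" \<omega> w \<rho> by fact
  note stationary_iff = stationary_nm_K_iff[OF \<theta> R]
  obtain \<mu> where \<mu>: "invariant \<mu>" using invariant_exists_unique by blast
  show "\<exists>!\<pi>. stationary_distribution joint_space (nm_K (\<gamma>, \<omega>, A, b)) \<pi>"
    unfolding stationary_iff using \<mu> invariant_unique by blast
  assume "stationary_distribution joint_space (nm_K (\<gamma>, \<omega>, A, b)) \<pi>"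
  then obtain \<nu> where \<nu>: "invariant \<nu>" "\<pi> = joint_law \<gamma> \<nu>" unfolding stationary_iff by blast
  then have "distr \<pi> state_measure fst = \<nu>"
    using distr_joint_law_fst[of \<gamma> \<nu>] \<theta> by (simp add: param_space_def invariant_def)
  with \<nu>(1) have inv: "invariant (distr \<pi> state_measure fst)" by simp
  obtain c where c: "0 < c" "\<And>x. norm x \<le> c * wnorm w x" using norm_le_wnorm[OF w_pos] by blast
  obtain C where C: "0 < C" "\<And>x. V x \<le> C * norm x" using is_norm_equivalent[OF V] by metis
  have "V x \<le> C * c * wnorm w x" for x
    unfolding mult.assoc by (rule order_trans[OF C(2) mult_left_mono[OF c(2) less_imp_le[OF C(1)]]])
  then have "(\<integral>\<^sup>+x. ennreal (V x) \<partial>distr \<pi> state_measure fst)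
    \<le> (\<integral>\<^sup>+x. ennreal (C * c) * ennreal (wnorm w x) \<partial>distr \<pi> state_measure fst)"
    using c(1) C(1) by (intro nn_integral_mono) (simp add: ennreal_leI flip: ennreal_mult')
  also have "\<dots> = ennreal (C * c) * (\<integral>\<^sup>+x. ennreal (wnorm w x) \<partial>distr \<pi> state_measure fst)"
    by (intro nn_integral_cmult) (auto intro!: measurable_compose[OF borel_measurable_state_measure measurable_ennreal])
  also have "\<dots> < \<infinity>"
    using invariant_mean_finite[OF inv] by (simp add: ennreal_mult_less_top)
  finally show "(\<integral>\<^sup>+x. ennreal (V x) \<partial>distr \<pi> state_measure fst) < \<infinity>" .
qed

lemma omega_lower_bound:
  fixes \<Theta> :: "'n::finite param set"
  assumes "compact \<Theta>" "\<Theta> \<subseteq> param_space"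
  obtains m where "0 < m" "\<And>\<gamma> \<omega> A b i. (\<gamma>, \<omega>, A, b) \<in> \<Theta> \<Longrightarrow> m \<le> \<omega> $ i"
proof (cases "\<Theta> = {}")
  case False
  have "\<exists>m>0. \<forall>(\<gamma>, \<omega>, A, b)\<in>\<Theta>. m \<le> \<omega> $ i" for i
  proof -
    have "continuous_on \<Theta> (\<lambda>\<theta>. fst (snd \<theta>) $ i)" by (intro continuous_intros)
    from continuous_attains_inf[OF assms(1) False this]
    obtain \<theta> where "\<theta> \<in> \<Theta>" "\<forall>\<theta>'\<in>\<Theta>. fst (snd \<theta>) $ i \<le> fst (snd \<theta>') $ i" by blast
    moreover have "0 < fst (snd \<theta>) $ i"
      using \<open>\<theta> \<in> \<Theta>\<close> assms(2) by (auto simp: param_space_def posvecs_def)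
    ultimately show ?thesis by (intro exI[of _ "fst (snd \<theta>) $ i"]) auto
  qed
  then obtain m where m: "\<And>i. 0 < m i" "\<And>i \<gamma> \<omega> A b. (\<gamma>, \<omega>, A, b) \<in> \<Theta> \<Longrightarrow> m i \<le> \<omega> $ i"
    by (metis (mono_tags, lifting) case_prodD)
  have "Min (range m) \<in> range m" by (intro Min_in) auto
  then have "0 < Min (range m)" using m(1) by auto
  moreover have "Min (range m) \<le> m i" for i by (intro Min_le) auto
  ultimately show ?thesis using m(2) that[of "Min (range m)"] order_trans by blast
qed (use that[of 1] in auto)

text \<open>The update at \<open>y = 0\<close> and the coefficient of \<open>y\<^sup>2\<close> are continuous in the parameter, hence bounded on
a compact set.\<close>

lemma nm_psi_growth:
  fixes \<Theta> :: "'n::finite param set" and x :: "real^'n"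
  assumes "compact \<Theta>"
  obtains B where "1 \<le> B" "\<And>\<theta> y. \<theta> \<in> \<Theta> \<Longrightarrow> norm (nm_psi \<theta> y x - x) \<le> B * (1 + y\<^sup>2)"
proof -
  have "continuous_on \<Theta> (\<lambda>\<theta>. (\<theta>, x))" by (intro continuous_intros)
  from continuous_on_compose2[OF continuous_on_nm_psi[of UNIV 0] this]
  have "continuous_on \<Theta> (\<lambda>\<theta>. nm_psi \<theta> 0 x - x)" by (intro continuous_intros) simp
  then have "bounded ((\<lambda>\<theta>. nm_psi \<theta> 0 x - x) ` \<Theta>)"
    by (intro compact_imp_bounded compact_continuous_image assms)
  then obtain B1 where B1: "\<And>\<theta>. \<theta> \<in> \<Theta> \<Longrightarrow> norm (nm_psi \<theta> 0 x - x) \<le> B1"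
    unfolding bounded_iff by blast
  have "continuous_on \<Theta> (\<lambda>\<theta>. snd (snd (snd \<theta>)))" by (intro continuous_intros)
  then have "bounded ((\<lambda>\<theta>. snd (snd (snd \<theta>))) ` \<Theta>)"
    by (intro compact_imp_bounded compact_continuous_image assms)
  then obtain B2 where B2: "\<And>\<theta>. \<theta> \<in> \<Theta> \<Longrightarrow> norm (snd (snd (snd \<theta>))) \<le> B2"
    unfolding bounded_iff by blast
  define B where "B = max 1 (max B1 B2)"
  have "norm (nm_psi \<theta> y x - x) \<le> B * (1 + y\<^sup>2)" if "\<theta> \<in> \<Theta>" for \<theta> y
  proof -
    have eq: "nm_psi \<theta> y x - x = (nm_psi \<theta> 0 x - x) + y\<^sup>2 *\<^sub>R snd (snd (snd \<theta>))"
      by (cases \<theta>) (simp add: nm_psi_def)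
    have "norm (nm_psi \<theta> y x - x) \<le> norm (nm_psi \<theta> 0 x - x) + y\<^sup>2 * norm (snd (snd (snd \<theta>)))"
      unfolding eq by (rule order_trans[OF norm_triangle_ineq]) simp
    also have "\<dots> \<le> B + y\<^sup>2 * B"
      using B1[OF that] B2[OF that] by (intro add_mono mult_left_mono) (auto simp: B_def)
    finally show ?thesis by (simp add: algebra_simps)
  qed
  then show ?thesis by (intro that[of B]) (auto simp: B_def)
qed

theorem theorem7:
  fixes \<Theta> :: "'n::finite param set" and V :: "real^'n \<Rightarrow> real"
  assumes "compact \<Theta>" and "\<Theta> \<subseteq> param_space"
    and "\<forall>(\<gamma>, \<omega>, A, b)\<in>\<Theta>. spec_radius (A + outer_prod b \<gamma>) < 1"
    and "is_norm V"
  shows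
    "(\<forall>\<theta>\<in>\<Theta>. \<exists>!\<pi>. stationary_distribution (state_measure \<Otimes>\<^sub>M borel) (nm_K \<theta>) \<pi>) \<and>
     (\<forall>\<theta>\<in>\<Theta>. \<forall>\<pi>. stationary_distribution (state_measure \<Otimes>\<^sub>M borel) (nm_K \<theta>) \<pi> \<longrightarrow>
        (\<integral>\<^sup>+ x. ennreal (V x) \<partial>distr \<pi> state_measure fst) < \<infinity>) \<and>
     (\<forall>y. continuous_on (\<Theta> \<times> posvecs) (\<lambda>(\<theta>, x). nm_g \<theta> x y) \<and>
          continuous_on (\<Theta> \<times> posvecs) (\<lambda>(\<theta>, x). nm_psi \<theta> y x)) \<and>
     (\<exists>(d :: real^'n \<Rightarrow> real^'n \<Rightarrow> real) (x\<^sub>1 :: real^'n) (X\<^sub>1 :: (real^'n) set)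
        (\<rho> :: real) (C :: real) (\<psi>b :: real^'n \<Rightarrow> real) (H :: real \<Rightarrow> real) (\<phi>b :: real \<Rightarrow> real).
        metric_from_norm d \<and> x\<^sub>1 \<in> posvecs \<and> closedin (top_of_set posvecs) X\<^sub>1 \<and>
        0 < \<rho> \<and> \<rho> < 1 \<and> 0 \<le> C \<and>
        \<psi>b \<in> borel_measurable state_measure \<and> (\<forall>x\<in>posvecs. 0 \<le> \<psi>b x) \<and>
        H \<in> borel_measurable (restrict_space borel {0..}) \<and> (\<forall>u\<ge>0. 0 \<le> H u) \<and>
        \<phi>b \<in> borel_measurable borel \<and> (\<forall>y. 0 \<le> \<phi>b y) \<and>
        (\<forall>\<theta>\<in>\<Theta>. \<forall>x\<in>posvecs. \<forall>y. nm_psi \<theta> y x \<in> X\<^sub>1) \<and>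
        bdd_above ((\<lambda>(\<theta>, x, y). nm_g \<theta> x y) ` (\<Theta> \<times> X\<^sub>1 \<times> UNIV)) \<and>
        (\<forall>\<theta>\<in>\<Theta>. \<forall>n. \<forall>x\<in>posvecs. \<forall>ys. length ys = n \<longrightarrow>
           d (nm_psi_iter \<theta> ys x\<^sub>1) (nm_psi_iter \<theta> ys x) \<le> \<rho> ^ n * \<psi>b x) \<and>
        locally_bounded_on posvecs \<psi>b \<and>
        (\<forall>\<theta>\<in>\<Theta>. \<forall>y. \<psi>b (nm_psi \<theta> y x\<^sub>1) \<le> \<phi>b y) \<and>
        (\<forall>\<theta>\<in>\<Theta>. \<forall>x\<in>X\<^sub>1. \<forall>x'\<in>X\<^sub>1. \<forall>y.
           \<bar>ln (nm_g \<theta> x y / nm_g \<theta> x' y)\<bar>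
             \<le> H (d x x') * exp (C * max (d x\<^sub>1 x) (d x\<^sub>1 x')) * \<phi>b y) \<and>
        H \<in> O[at_right 0](\<lambda>u. u) \<and>
        (if C = 0
         then \<forall>\<theta>\<in>\<Theta>. dominated_on posvecs (kernel_int (nm_G \<theta>) (\<lambda>y. ln_plus (\<phi>b y))) V
         else \<forall>\<theta>\<in>\<Theta>. dominated_on posvecs (kernel_int (nm_G \<theta>) \<phi>b) V))"
proof (intro conjI)
  have spec: "spec_radius (A + outer_prod b \<gamma>) < 1" if "(\<gamma>, \<omega>, A, b) \<in> \<Theta>" for \<gamma> \<omega> A b
    using assms(3) that by auto
  have param: "(\<gamma>, \<omega>, A, b) \<in> param_space" if "(\<gamma>, \<omega>, A, b) \<in> \<Theta>" for \<gamma> \<omega> A b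
    using assms(2) that by auto
  have weights: "\<gamma> \<in> simplex_weights" if "(\<gamma>, \<omega>, A, b) \<in> \<Theta>" for \<gamma> \<omega> A b
    using param[OF that] by (simp add: param_space_def)
  show "\<forall>\<theta>\<in>\<Theta>. \<exists>!\<pi>. stationary_distribution (state_measure \<Otimes>\<^sub>M borel) (nm_K \<theta>) \<pi>"
    using nm_stationary(1)[OF param spec assms(4)] by (metis prod_cases4)
  show "\<forall>\<theta>\<in>\<Theta>. \<forall>\<pi>. stationary_distribution (state_measure \<Otimes>\<^sub>M borel) (nm_K \<theta>) \<pi> \<longrightarrow>
        (\<integral>\<^sup>+ x. ennreal (V x) \<partial>distr \<pi> state_measure fst) < \<infinity>"
    using nm_stationary(2)[OF param spec assms(4)] by (metis prod_cases4)
  show "\<forall>y. continuous_on (\<Theta> \<times> posvecs) (\<lambda>(\<theta>, x). nm_g \<theta> x y) \<and>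
          continuous_on (\<Theta> \<times> posvecs) (\<lambda>(\<theta>, x). nm_psi \<theta> y x)"
    using continuous_on_nm_g continuous_on_nm_psi by blast
  obtain c \<rho> where c: "1 \<le> c" and \<rho>: "0 < \<rho>" "\<rho> < 1"
    and contract: "\<And>\<gamma> \<omega> A b n v. (\<gamma>, \<omega>, A, b) \<in> \<Theta> \<Longrightarrow> norm (((*v) A ^^ n) v) \<le> c * \<rho> ^ n * norm v"
    using uniform_contraction[OF assms(1-3)] by metis
  obtain m where m: "0 < m" "\<And>\<gamma> \<omega> A b i. (\<gamma>, \<omega>, A, b) \<in> \<Theta> \<Longrightarrow> m \<le> \<omega> $ i"
    using omega_lower_bound[OF assms(1,2)] by metis
  obtain B where B: "1 \<le> B" "\<And>\<theta> y. \<theta> \<in> \<Theta> \<Longrightarrow> norm (nm_psi \<theta> y (1::real^'n) - 1) \<le> B * (1 + y\<^sup>2)"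
    using nm_psi_growth[OF assms(1), of 1] by metis
  obtain v where v: "0 < v" "\<And>x. v * norm x \<le> V x"
    using is_norm_equivalent[OF assms(4)] by metis
  \<comment> \<open>The scale of the metric is small enough that \<open>c * s * norm (nm_psi \<theta> y 1 - 1)\<close> is at most
  \<open>1 + y\<^sup>2\<close> with no constant in front, whose positive logarithm would not vanish at \<open>y = 0\<close>.\<close>
  define s where "s = 1 / (c * B)"
  have s: "0 < s" "c * s * B = 1" using c B(1) by (auto simp: s_def)
  \<comment> \<open>The slope of the modulus \<open>H u = K * u\<close> undoes the scaling in the bound on the log density.\<close>
  define K where "K = (1 / m + 1 / m\<^sup>2) / s"
  have K: "0 \<le> K" "K * s = 1 / m + 1 / m\<^sup>2" using m(1) s by (auto simp: K_def)
  define X1 :: "(real^'n) set" where "X1 = {x. \<forall>i. m \<le> x $ i}"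
  have X1_pos: "X1 \<subseteq> posvecs" using m(1) by (auto simp: X1_def posvecs_def intro: less_le_trans)
  let ?d = "\<lambda>x x' :: real^'n. s * norm (x - x')"
  let ?\<psi> = "\<lambda>x :: real^'n. c * (s * norm (x - 1))"
  show "\<exists>(d :: real^'n \<Rightarrow> real^'n \<Rightarrow> real) (x\<^sub>1 :: real^'n) (X\<^sub>1 :: (real^'n) set)
        (\<rho> :: real) (C :: real) (\<psi>b :: real^'n \<Rightarrow> real) (H :: real \<Rightarrow> real) (\<phi>b :: real \<Rightarrow> real).
        metric_from_norm d \<and> x\<^sub>1 \<in> posvecs \<and> closedin (top_of_set posvecs) X\<^sub>1 \<and>
        0 < \<rho> \<and> \<rho> < 1 \<and> 0 \<le> C \<and>
        \<psi>b \<in> borel_measurable state_measure \<and> (\<forall>x\<in>posvecs. 0 \<le> \<psi>b x) \<and>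
        H \<in> borel_measurable (restrict_space borel {0..}) \<and> (\<forall>u\<ge>0. 0 \<le> H u) \<and>
        \<phi>b \<in> borel_measurable borel \<and> (\<forall>y. 0 \<le> \<phi>b y) \<and>
        (\<forall>\<theta>\<in>\<Theta>. \<forall>x\<in>posvecs. \<forall>y. nm_psi \<theta> y x \<in> X\<^sub>1) \<and>
        bdd_above ((\<lambda>(\<theta>, x, y). nm_g \<theta> x y) ` (\<Theta> \<times> X\<^sub>1 \<times> UNIV)) \<and>
        (\<forall>\<theta>\<in>\<Theta>. \<forall>n. \<forall>x\<in>posvecs. \<forall>ys. length ys = n \<longrightarrow>
           d (nm_psi_iter \<theta> ys x\<^sub>1) (nm_psi_iter \<theta> ys x) \<le> \<rho> ^ n * \<psi>b x) \<and>
        locally_bounded_on posvecs \<psi>b \<and>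
        (\<forall>\<theta>\<in>\<Theta>. \<forall>y. \<psi>b (nm_psi \<theta> y x\<^sub>1) \<le> \<phi>b y) \<and>
        (\<forall>\<theta>\<in>\<Theta>. \<forall>x\<in>X\<^sub>1. \<forall>x'\<in>X\<^sub>1. \<forall>y.
           \<bar>ln (nm_g \<theta> x y / nm_g \<theta> x' y)\<bar>
             \<le> H (d x x') * exp (C * max (d x\<^sub>1 x) (d x\<^sub>1 x')) * \<phi>b y) \<and>
        H \<in> O[at_right 0](\<lambda>u. u) \<and>
        (if C = 0
         then \<forall>\<theta>\<in>\<Theta>. dominated_on posvecs (kernel_int (nm_G \<theta>) (\<lambda>y. ln_plus (\<phi>b y))) V
         else \<forall>\<theta>\<in>\<Theta>. dominated_on posvecs (kernel_int (nm_G \<theta>) \<phi>b) V)"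
  proof (intro exI conjI)
    show "metric_from_norm ?d"
      unfolding metric_from_norm_def is_norm_def
      using s(1) by (intro exI[of _ "\<lambda>x. s * norm x"])
        (auto simp: mult_left_mono norm_triangle_ineq simp flip: distrib_left)
    show "1 \<in> posvecs" by (simp add: posvecs_def)
    have "closed X1"
    proof -
      have "X1 = (\<Inter>i. {x. m \<le> x $ i})" by (auto simp: X1_def)
      also have "closed \<dots>" by (intro closed_INT ballI closed_Collect_le continuous_intros)
      finally show ?thesis .
    qed
    then show "closedin (top_of_set posvecs) X1"
      using closed_subset[OF X1_pos] by blast
    show "0 < \<rho>" "\<rho> < 1" "(0::real) \<le> 0" by (fact \<rho>, fact \<rho>, simp)
    show "?\<psi> \<in> borel_measurable state_measure"
      by (intro borel_measurable_state_measure borel_measurable_continuous_onI continuous_intros)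
    show "\<forall>x\<in>posvecs. 0 \<le> ?\<psi> x" using c s by simp
    show "(\<lambda>u. K * u) \<in> borel_measurable (restrict_space borel {0..})"
      by (rule measurable_restrict_space1) simp
    show "\<forall>u\<ge>0. 0 \<le> K * u" using K by simp
    show "(\<lambda>y. 1 + y\<^sup>2) \<in> borel_measurable (borel :: real measure)" by simp
    show "\<forall>y::real. 0 \<le> 1 + y\<^sup>2" by simp
    show "\<forall>\<theta>\<in>\<Theta>. \<forall>x\<in>posvecs. \<forall>y. nm_psi \<theta> y x \<in> X1"
    proof (intro ballI allI)
      fix \<theta> x y assume "\<theta> \<in> \<Theta>" and x: "(x :: real^'n) \<in> posvecs"
      obtain \<gamma> \<omega> A b where \<theta>: "\<theta> = (\<gamma>, \<omega>, A, b)" by (cases \<theta>) auto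
      have "(\<gamma>, \<omega>, A, b) \<in> \<Theta>" using \<open>\<theta> \<in> \<Theta>\<close> \<theta> by simp
      then have "m \<le> nm_psi \<theta> y x $ i" for i
        unfolding \<theta> using m(2) nm_psi_posvecs(1)[OF param x] order_trans by blast
      then show "nm_psi \<theta> y x \<in> X1" by (simp add: X1_def)
    qed
    show "bdd_above ((\<lambda>(\<theta>, x, y). nm_g \<theta> x y) ` (\<Theta> \<times> X1 \<times> UNIV))"
      using nm_g_bounded[OF weights m(1)]
      by (intro bdd_aboveI[of _ "1 / sqrt (2 * pi * m)"]) (auto simp: X1_def)
    show "\<forall>\<theta>\<in>\<Theta>. \<forall>n. \<forall>x\<in>posvecs. \<forall>ys. length ys = n \<longrightarrow>
           ?d (nm_psi_iter \<theta> ys 1) (nm_psi_iter \<theta> ys x) \<le> \<rho> ^ n * ?\<psi> x"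
    proof (intro ballI allI impI)
      fix \<theta> n x and ys :: "real list" assume "\<theta> \<in> \<Theta>" and n: "length ys = n"
      obtain \<gamma> \<omega> A b where \<theta>: "\<theta> = (\<gamma>, \<omega>, A, b)" by (cases \<theta>) auto
      have "norm (nm_psi_iter \<theta> ys 1 - nm_psi_iter \<theta> ys x) \<le> c * \<rho> ^ n * norm (1 - x)"
        using contract[of \<gamma> \<omega> A b n "1 - x"] \<open>\<theta> \<in> \<Theta>\<close> by (simp add: \<theta> nm_psi_iter_diff n)
      from mult_left_mono[OF this, of s] s(1)
      show "?d (nm_psi_iter \<theta> ys 1) (nm_psi_iter \<theta> ys x) \<le> \<rho> ^ n * ?\<psi> x"
        by (simp add: ac_simps norm_minus_commute)
    qed
    show "locally_bounded_on posvecs ?\<psi>"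
      unfolding locally_bounded_on_def
    proof
      fix x :: "real^'n"
      have "bounded (?\<psi> ` cball x 1)"
        by (intro compact_imp_bounded compact_continuous_image continuous_intros compact_cball)
      then have "bounded (?\<psi> ` (ball x 1 \<inter> posvecs))"
        by (rule bounded_subset) (auto simp: less_imp_le)
      then show "\<exists>U. open U \<and> x \<in> U \<and> bounded (?\<psi> ` (U \<inter> posvecs))"
        by (intro exI[of _ "ball x 1"]) auto
    qed
    show "\<forall>\<theta>\<in>\<Theta>. \<forall>y. ?\<psi> (nm_psi \<theta> y 1) \<le> 1 + y\<^sup>2"
    proof (intro ballI allI)
      fix \<theta> y assume "\<theta> \<in> \<Theta>"
      have "c * s * norm (nm_psi \<theta> y 1 - 1) \<le> c * s * (B * (1 + y\<^sup>2))"
        using c s(1) B(2)[OF \<open>\<theta> \<in> \<Theta>\<close>] by (intro mult_left_mono) auto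
      also have "\<dots> = 1 + y\<^sup>2" using s(2) by (simp flip: mult.assoc)
      finally show "?\<psi> (nm_psi \<theta> y 1) \<le> 1 + y\<^sup>2" by (simp add: mult.assoc)
    qed
    show "\<forall>\<theta>\<in>\<Theta>. \<forall>x\<in>X1. \<forall>x'\<in>X1. \<forall>y.
           \<bar>ln (nm_g \<theta> x y / nm_g \<theta> x' y)\<bar>
             \<le> K * ?d x x' * exp (0 * max (?d 1 x) (?d 1 x')) * (1 + y\<^sup>2)"
    proof (intro ballI allI)
      fix \<theta> x x' y assume "\<theta> \<in> \<Theta>" and x: "x \<in> X1" "x' \<in> X1"
      obtain \<gamma> \<omega> A b where \<theta>: "\<theta> = (\<gamma>, \<omega>, A, b)" by (cases \<theta>) auto
      have "\<bar>ln (nm_g \<theta> x y / nm_g \<theta> x' y)\<bar> \<le> (1 / (2 * m) + y\<^sup>2 / (2 * m\<^sup>2)) * norm (x - x')"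
        unfolding \<theta> using x \<open>\<theta> \<in> \<Theta>\<close>
        by (intro ln_nm_g_ratio_le[OF _ m(1)] weights[of \<gamma> \<omega> A b]) (auto simp: X1_def \<theta>)
      also have "\<dots> \<le> ((1 / m + 1 / m\<^sup>2) * (1 + y\<^sup>2)) * norm (x - x')"
      proof (rule mult_right_mono)
        have "1 / (2 * m) \<le> 1 / m" "y\<^sup>2 / (2 * m\<^sup>2) \<le> 1 / m\<^sup>2 * y\<^sup>2" "0 \<le> 1 / m * y\<^sup>2" "0 \<le> 1 / m\<^sup>2"
          using m(1) by (auto intro!: divide_left_mono)
        then show "1 / (2 * m) + y\<^sup>2 / (2 * m\<^sup>2) \<le> (1 / m + 1 / m\<^sup>2) * (1 + y\<^sup>2)"
          unfolding distrib_left distrib_right mult_1_right by linarith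
      qed simp
      also have "\<dots> = K * ?d x x' * exp (0 * max (?d 1 x) (?d 1 x')) * (1 + y\<^sup>2)"
        unfolding K(2)[symmetric] by simp
      finally show "\<bar>ln (nm_g \<theta> x y / nm_g \<theta> x' y)\<bar>
        \<le> K * ?d x x' * exp (0 * max (?d 1 x) (?d 1 x')) * (1 + y\<^sup>2)" .
    qed
    show "(\<lambda>u. K * u) \<in> O[at_right 0](\<lambda>u. u)" by simp
    have "dominated_on posvecs (kernel_int (nm_G \<theta>) (\<lambda>y. ln_plus (1 + y\<^sup>2))) V" if "\<theta> \<in> \<Theta>" for \<theta>
      unfolding dominated_on_def
    proof (intro exI[of _ "1 / v"] conjI ballI)
      fix x :: "real^'n" assume x: "x \<in> posvecs"
      obtain \<gamma> \<omega> A b where \<theta>: "\<theta> = (\<gamma>, \<omega>, A, b)" by (cases \<theta>) auto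
      have "kernel_int (nm_G \<theta>) (\<lambda>y. ln_plus (1 + y\<^sup>2)) x \<le> ennreal (norm x)"
        unfolding \<theta> using that \<theta> by (intro nm_G_ln_plus_le weights[of \<gamma> \<omega> A b] x) simp
      also have "\<dots> \<le> ennreal (1 / v * V x)"
        using v(1) v(2)[of x] by (intro ennreal_leI) (simp add: field_simps)
      finally show "kernel_int (nm_G \<theta>) (\<lambda>y. ln_plus (1 + y\<^sup>2)) x \<le> ennreal (1 / v * V x)" .
    qed (use v in simp)
    then show "if (0::real) = 0
         then \<forall>\<theta>\<in>\<Theta>. dominated_on posvecs (kernel_int (nm_G \<theta>) (\<lambda>y. ln_plus (1 + y\<^sup>2))) V
         else \<forall>\<theta>\<in>\<Theta>. dominated_on posvecs (kernel_int (nm_G \<theta>) (\<lambda>y. 1 + y\<^sup>2)) V" by simp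
  qed
qed

end
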